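(* Let $\mathbb{K}$ be a field, $n\ge 1$, $\alpha,\beta\in\mathbb{K}$ and $\phi\in\mathbb{K}[t_1,\dots,t_n]$. Then the algebra $\mathcal{A}(\alpha,\beta,\phi)$ is a prime ring except in the case when $\alpha=\beta=\phi=0$; that is, $\mathcal{A}(\alpha,\beta,\phi)$ is prime if and only if $\alpha,\beta,\phi$ are not all zero.
   Context: $\mathcal{A}(\alpha,\beta,\phi)$ denotes the (unital associative) $\mathbb{K}$-algebra generated by $u,d,t_1,\dots,t_n$ subject to the relations $t_it_j=t_jt_i$, $t_iu=ut_i$, $t_id=dt_i$ for all $i,j\in\{1,\dots,n\}$, together with $d^{2}u=\alpha\, dud+\beta\, ud^{2}+\phi(t_1,\dots,t_n)d$ and $du^{2}=\alpha\, udu+\beta\, u^{2}d+u\phi(t_1,\dots,t_n)$. *)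

theory Defs
  imports "HOL-Algebra.QuotRing" "HOL-Library.Poly_Mapping"
begin

text \<open>
  The free monoid, written additively (concatenation is \<open>+\<close>, the empty word is \<open>0\<close>) because the
  convolution product on \<^typ>\<open>'m \<Rightarrow>\<^sub>0 'k\<close> takes its monoid operation from \<^class>\<open>monoid_add\<close>.
  Thus \<^typ>\<open>'m \<Rightarrow>\<^sub>0 'k\<close> is the monoid algebra of \<open>'m\<close> over \<open>'k\<close>.
\<close>

datatype 'a free_monoid = Word (letters: "'a list")

instantiation free_monoid :: (type) monoid_add
begin

definition zero_free_monoid :: "'a free_monoid"
  where "0 = Word []"

definition plus_free_monoid :: "'a free_monoid \<Rightarrow> 'a free_monoid \<Rightarrow> 'a free_monoid"
  where "v + w = Word (letters v @ letters w)"

instance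
  by standard (simp_all add: zero_free_monoid_def plus_free_monoid_def)

end

text \<open>The free unital associative algebra on the set of all elements of \<open>'a\<close>.\<close>

type_synonym ('a, 'k) free_algebra = "'a free_monoid \<Rightarrow>\<^sub>0 'k"

definition scalar :: "'k \<Rightarrow> ('a, 'k::field) free_algebra"
  where "scalar c = Poly_Mapping.single 0 c"

definition gen :: "'a \<Rightarrow> ('a, 'k::field) free_algebra"
  where "gen x = Poly_Mapping.single (Word [x]) 1"

text \<open>
  The index set \<open>{1, \<dots>, n}\<close> is a finite linearly ordered type \<open>'n\<close> with \<open>n = CARD('n)\<close>; it is never
  empty, so \<open>n \<ge> 1\<close>. A polynomial in \<open>t\<^sub>1, \<dots>, t\<^sub>n\<close> over \<open>'k\<close> is an element of the monoid algebra of
  the exponent vectors \<^typ>\<open>'n \<Rightarrow>\<^sub>0 nat\<close>.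
\<close>

datatype 'n letter = U | D | T 'n

type_synonym ('n, 'k) mpoly = "('n \<Rightarrow>\<^sub>0 nat) \<Rightarrow>\<^sub>0 'k"

text \<open>
  \<open>\<phi>(t\<^sub>1, \<dots>, t\<^sub>n)\<close> as an element of the free algebra, where the \<open>t\<^sub>i\<close> do not commute yet: each monomial
  is written with its variables in increasing order. Since the relations below contain all
  \<open>t\<^sub>i t\<^sub>j - t\<^sub>j t\<^sub>i\<close>, any other order gives the same element of the quotient.
\<close>

definition eval_t ::
  "('n::{finite,linorder}, 'k::field) mpoly \<Rightarrow> ('n letter, 'k) free_algebra"
  where "eval_t \<phi> =
    (\<Sum>m\<in>Poly_Mapping.keys \<phi>.
       scalar (Poly_Mapping.lookup \<phi> m) *
       prod_list (map (\<lambda>i. gen (T i) ^ Poly_Mapping.lookup m i) (sorted_list_of_set UNIV)))"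

text \<open>An equation \<open>l = r\<close> between generators is represented by the element \<open>l - r\<close>.\<close>

definition relations ::
  "'k \<Rightarrow> 'k \<Rightarrow> ('n::{finite,linorder}, 'k::field) mpoly \<Rightarrow> ('n letter, 'k) free_algebra set"
  where "relations \<alpha> \<beta> \<phi> =
    (let u = gen U; d = gen D; t = (\<lambda>i. gen (T i)) in
      {t i * t j - t j * t i | i j. True} \<union>
      {t i * u - u * t i | i. True} \<union>
      {t i * d - d * t i | i. True} \<union>
      {d^2 * u - (scalar \<alpha> * (d * u * d) + scalar \<beta> * (u * d^2) + eval_t \<phi> * d),
       d * u^2 - (scalar \<alpha> * (u * d * u) + scalar \<beta> * (u^2 * d) + u * eval_t \<phi>)})"

definition ring_of_class :: "'r::ring_1 ring"
  where "ring_of_class = \<lparr>carrier = UNIV, mult = (*), one = 1, zero = 0, add = (+)\<rparr>"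

text \<open>
  The underlying ring of \<open>\<A>(\<alpha>,\<beta>,\<phi>)\<close>. Scalars are elements of the free algebra, so its ring ideals
  coincide with its algebra ideals.
\<close>

definition down_up_algebra ::
  "'k \<Rightarrow> 'k \<Rightarrow> ('n::{finite,linorder}, 'k::field) mpoly \<Rightarrow> ('n letter, 'k) free_algebra set ring"
  where "down_up_algebra \<alpha> \<beta> \<phi> =
    ring_of_class Quot (Idl\<^bsub>ring_of_class\<^esub> (relations \<alpha> \<beta> \<phi>))"

text \<open>
  The library's \<^locale>\<open>primeideal\<close> is the commutative (completely prime) notion, so primeness of a
  noncommutative ring is defined here.
\<close>

definition prime_ring :: "('a, 'm) ring_scheme \<Rightarrow> bool"
  where "prime_ring R \<longleftrightarrow>
    ring R \<and> \<one>\<^bsub>R\<^esub> \<noteq> \<zero>\<^bsub>R\<^esub> \<and>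
    (\<forall>a\<in>carrier R. \<forall>b\<in>carrier R.
       (\<forall>r\<in>carrier R. a \<otimes>\<^bsub>R\<^esub> r \<otimes>\<^bsub>R\<^esub> b = \<zero>\<^bsub>R\<^esub>) \<longrightarrow> a = \<zero>\<^bsub>R\<^esub> \<or> b = \<zero>\<^bsub>R\<^esub>)"

text \<open>Equivalently, a product of two nonzero two-sided ideals is nonzero.\<close>

lemma prime_ring_iff_ideals:
  "prime_ring R \<longleftrightarrow>
    ring R \<and> \<one>\<^bsub>R\<^esub> \<noteq> \<zero>\<^bsub>R\<^esub> \<and>
    (\<forall>I J. ideal I R \<longrightarrow> ideal J R \<longrightarrow> (\<forall>x\<in>I. \<forall>y\<in>J. x \<otimes>\<^bsub>R\<^esub> y = \<zero>\<^bsub>R\<^esub>) \<longrightarrow>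
       I = {\<zero>\<^bsub>R\<^esub>} \<or> J = {\<zero>\<^bsub>R\<^esub>})"
  (is "?L \<longleftrightarrow> ?R")
proof
  assume L: ?L
  then interpret ring R by (simp add: prime_ring_def)
  have "I = {\<zero>\<^bsub>R\<^esub>} \<or> J = {\<zero>\<^bsub>R\<^esub>}"
    if I: "ideal I R" and J: "ideal J R" and IJ: "\<forall>x\<in>I. \<forall>y\<in>J. x \<otimes>\<^bsub>R\<^esub> y = \<zero>\<^bsub>R\<^esub>" for I J
  proof (rule ccontr)
    assume "\<not> ?thesis"
    moreover have "\<zero>\<^bsub>R\<^esub> \<in> I" "\<zero>\<^bsub>R\<^esub> \<in> J"
      using I J by (auto intro: additive_subgroup.zero_closed ideal.axioms(1))
    ultimately obtain a b where ab: "a \<in> I" "b \<in> J" "a \<noteq> \<zero>\<^bsub>R\<^esub>" "b \<noteq> \<zero>\<^bsub>R\<^esub>" by blast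
    have "a \<in> carrier R" "b \<in> carrier R"
      using ab I J by (auto intro: ideal.Icarr)
    moreover have "\<forall>r\<in>carrier R. a \<otimes>\<^bsub>R\<^esub> r \<otimes>\<^bsub>R\<^esub> b = \<zero>\<^bsub>R\<^esub>"
      using IJ ab ideal.I_r_closed[OF I] by blast
    ultimately show False using L ab by (auto simp: prime_ring_def)
  qed
  with L show ?R by (auto simp: prime_ring_def)
next
  assume R: ?R
  then interpret ring R by simp
  have "a = \<zero>\<^bsub>R\<^esub> \<or> b = \<zero>\<^bsub>R\<^esub>"
    if ab: "a \<in> carrier R" "b \<in> carrier R"
      and 0: "\<forall>r\<in>carrier R. a \<otimes>\<^bsub>R\<^esub> r \<otimes>\<^bsub>R\<^esub> b = \<zero>\<^bsub>R\<^esub>" for a b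
  proof -
    define I where "I = {x \<in> carrier R. \<forall>r\<in>carrier R. x \<otimes>\<^bsub>R\<^esub> r \<otimes>\<^bsub>R\<^esub> b = \<zero>\<^bsub>R\<^esub>}"
    define J where "J = {y \<in> carrier R. \<forall>x\<in>I. x \<otimes>\<^bsub>R\<^esub> y = \<zero>\<^bsub>R\<^esub>}"
    have I: "ideal I R"
    proof (rule idealI)
      show "subgroup I (add_monoid R)"
      proof (rule add.subgroupI)
        show "I \<subseteq> carrier R" "I \<noteq> {}" using ab by (auto simp: I_def)
      qed (use ab in \<open>auto simp: I_def l_distr l_minus simp flip: a_inv_def\<close>)
    next
      fix y x assume y: "y \<in> I" and x: "x \<in> carrier R"
      have "x \<otimes>\<^bsub>R\<^esub> y \<otimes>\<^bsub>R\<^esub> r \<otimes>\<^bsub>R\<^esub> b = x \<otimes>\<^bsub>R\<^esub> (y \<otimes>\<^bsub>R\<^esub> r \<otimes>\<^bsub>R\<^esub> b)" if "r \<in> carrier R" for r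
        using that x y ab by (simp add: I_def m_assoc)
      then show "x \<otimes>\<^bsub>R\<^esub> y \<in> I" using x y by (simp add: I_def)
      have "y \<otimes>\<^bsub>R\<^esub> x \<otimes>\<^bsub>R\<^esub> r \<otimes>\<^bsub>R\<^esub> b = y \<otimes>\<^bsub>R\<^esub> (x \<otimes>\<^bsub>R\<^esub> r) \<otimes>\<^bsub>R\<^esub> b" if "r \<in> carrier R" for r
        using that x y ab by (simp add: I_def m_assoc)
      then show "y \<otimes>\<^bsub>R\<^esub> x \<in> I" using x y by (simp add: I_def)
    qed (rule ring_axioms)
    have Icarr: "x \<in> carrier R" if "x \<in> I" for x using that by (simp add: I_def)
    have J: "ideal J R"
    proof (rule idealI)
      show "subgroup J (add_monoid R)"
      proof (rule add.subgroupI)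
        show "J \<subseteq> carrier R" "J \<noteq> {}" using Icarr by (auto simp: J_def intro!: exI[of _ "\<zero>\<^bsub>R\<^esub>"])
      qed (use Icarr in \<open>auto simp: J_def r_distr r_minus simp flip: a_inv_def\<close>)
    next
      fix y x assume y: "y \<in> J" and x: "x \<in> carrier R"
      have "z \<otimes>\<^bsub>R\<^esub> (x \<otimes>\<^bsub>R\<^esub> y) = (z \<otimes>\<^bsub>R\<^esub> x) \<otimes>\<^bsub>R\<^esub> y" if "z \<in> I" for z
        using that x y Icarr by (simp add: J_def m_assoc)
      moreover have "z \<otimes>\<^bsub>R\<^esub> x \<in> I" if "z \<in> I" for z
        using ideal.I_r_closed[OF I that x] .
      ultimately show "x \<otimes>\<^bsub>R\<^esub> y \<in> J" using x y by (simp add: J_def)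
      have "z \<otimes>\<^bsub>R\<^esub> (y \<otimes>\<^bsub>R\<^esub> x) = (z \<otimes>\<^bsub>R\<^esub> y) \<otimes>\<^bsub>R\<^esub> x" if "z \<in> I" for z
        by (rule m_assoc[symmetric]) (use that x y Icarr in \<open>simp_all add: J_def\<close>)
      then show "y \<otimes>\<^bsub>R\<^esub> x \<in> J" using x y by (simp add: J_def)
    qed (rule ring_axioms)
    have aI: "a \<in> I" using ab 0 by (simp add: I_def)
    have "x \<otimes>\<^bsub>R\<^esub> b = \<zero>\<^bsub>R\<^esub>" if "x \<in> I" for x
    proof -
      have "x \<otimes>\<^bsub>R\<^esub> \<one>\<^bsub>R\<^esub> \<otimes>\<^bsub>R\<^esub> b = \<zero>\<^bsub>R\<^esub>" using that unfolding I_def by blast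
      with Icarr[OF that] show ?thesis by simp
    qed
    then have bJ: "b \<in> J" using ab by (simp add: J_def)
    have "\<forall>x\<in>I. \<forall>y\<in>J. x \<otimes>\<^bsub>R\<^esub> y = \<zero>\<^bsub>R\<^esub>" by (simp add: J_def)
    with R I J have "I = {\<zero>\<^bsub>R\<^esub>} \<or> J = {\<zero>\<^bsub>R\<^esub>}" by blast
    with aI bJ show ?thesis by auto
  qed
  with R show ?L by (auto simp: prime_ring_def)
qed

lemma ring_ring_of_class: "ring (ring_of_class :: 'r::ring_1 ring)"
proof -
  have "\<exists>y. y + x = 0" for x :: 'r
    by (rule exI[of _ "- x"]) simp
  then show ?thesis
    by unfold_locales
       (auto simp: ring_of_class_def algebra_simps Units_def intro: exI[of _ "- _"])
qed

lemma ring_down_up_algebra: "ring (down_up_algebra \<alpha> \<beta> \<phi>)"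
  unfolding down_up_algebra_def
  by (intro ideal.quotient_is_ring ring.genideal_ideal ring_ring_of_class) (simp add: ring_of_class_def)

end

theory Submission
  imports Defs "HOL-Computational_Algebra.Polynomial"
begin

text \<open>
  The algebra is studied through the two commuting elements \<open>x = ud\<close> and \<open>y = du\<close>. The relations say
  that \<open>d f = \<sigma>(f) d\<close> and \<open>f u = u \<sigma>(f)\<close> for polynomials \<open>f\<close> in \<open>x\<close>, \<open>y\<close> and the central \<open>t\<^sub>i\<close>, where
  \<open>\<sigma>(x) = y\<close> and \<open>\<sigma>(y) = \<alpha>y + \<beta>x + \<phi>\<close>; for \<open>\<beta> \<noteq> 0\<close> this substitution is invertible. Pushing
  these polynomials around gives two spanning families: the elements \<open>u\<^sup>i f d\<^sup>k\<close>, with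
  \<open>f\<close> in \<open>y\<close> alone when \<open>\<beta> = 0\<close> (\<open>monomial_span\<close>), and for \<open>\<beta> \<noteq> 0\<close> also \<open>u\<^sup>i f(x, y)\<close> together with \<open>d\<^sup>i f(x, y)\<close>
  (\<open>signed_power_span\<close>).

  To see that an element is nonzero, let the algebra act by weighted shifts on vectors \<open>v\<^sub>n\<close>, with
  \<open>u v\<^sub>n\<close> a multiple of \<open>v\<^sub>n\<^sub>+\<^sub>1\<close> and \<open>d v\<^sub>n\<close> a multiple of \<open>v\<^sub>n\<^sub>-\<^sub>1\<close>. Such an action respects the relations
  when the eigenvalues \<open>\<kappa>(n)\<close> of \<open>ud\<close>, the weights, satisfy
  \<open>\<kappa>(n + 1) = \<alpha> \<kappa>(n) + \<beta> \<kappa>(n - 1) + \<phi>\<close> (\<open>act_relation_ideal\<close>). The coefficients are taken from a polynomial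
  ring, and some weights are independent variables, so that a polynomial in \<open>x\<close> and \<open>y\<close> acts on \<open>v\<^sub>0\<close> as
  itself (\<open>diag_act_nonzero_at_0\<close>).

  If \<open>\<beta> \<noteq> 0\<close>, the weights are taken for all integers \<open>n\<close>, with \<open>\<kappa>(0) = X\<close> and \<open>\<kappa>(1) = Y\<close>; all of them are
  nonzero (\<open>two_sided_weights\<close>). For nonzero \<open>a\<close> and \<open>b\<close>, the vector \<open>b v\<^sub>0\<close> has a topmost component, which a
  power of \<open>u\<close> or \<open>d\<close> moves back to \<open>v\<^sub>0\<close>; the top degree part of \<open>a\<close> does not kill the result.

  If \<open>\<beta> = 0\<close> and \<open>\<alpha>\<close>, \<open>\<phi>\<close> are not both zero, the Verma module with \<open>\<kappa>(0) = 0\<close> and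
  \<open>\<kappa>(1) = Y\<close> has nonzero weights at all positive indices (\<open>verma_weights\<close>). It is faithful: a nonzero \<open>a\<close>
  is detected on \<open>v\<^sub>k\<close>, where \<open>k\<close> is the least power of \<open>d\<close> that occurs in it (\<open>nonzero_on_basis_vector\<close>). Given
  nonzero \<open>a\<close> and \<open>b\<close>, take a vector on which \<open>b\<close> is nonzero, lower the result by a power of \<open>d\<close> to a
  nonzero multiple of \<open>v\<^sub>0\<close>, and raise it by a power of \<open>u\<close> to the vector that detects \<open>a\<close>.

  If all parameters vanish, then \<open>d\<^sup>2\<close> and \<open>u\<close> are nonzero, but \<open>d\<^sup>2 r u = 0\<close> for all \<open>r\<close>
  (\<open>degenerate_annihilation\<close>).
\<close>

section \<open>Free algebras and their quotients\<close>

lemma poly_mapping_sum_induct [case_names zero add monomial]: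
  fixes z :: "'m \<Rightarrow>\<^sub>0 'a::comm_monoid_add"
  assumes "P 0" and "\<And>a b. P a \<Longrightarrow> P b \<Longrightarrow> P (a + b)"
    and "\<And>w c. P (Poly_Mapping.single w c)"
  shows "P z"
proof -
  have "z = (\<Sum>w\<in>Poly_Mapping.keys z. Poly_Mapping.single w (Poly_Mapping.lookup z w))"
    by (rule poly_mapping_eqI)
       (auto simp: lookup_sum lookup_single when_def in_keys_iff sum.delta)
  moreover have "P (\<Sum>w\<in>A. Poly_Mapping.single w (Poly_Mapping.lookup z w))" if "finite A" for A
    using that by induction (use assms in auto)
  ultimately show ?thesis by (metis finite_keys)
qed

lemma single_Nil: "Poly_Mapping.single (Word []) c = scalar c"
  by (simp add: scalar_def zero_free_monoid_def)

lemma single_Cons: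
  "Poly_Mapping.single (Word (x # xs)) c = gen x * Poly_Mapping.single (Word xs) (c::'k::field)"
  by (simp add: gen_def mult_single plus_free_monoid_def)

lemma free_algebra_left_induct [case_names scalar add gen]:
  fixes z :: "('a, 'k::field) free_algebra"
  assumes s: "\<And>c. P (scalar c)" and add: "\<And>a b. P a \<Longrightarrow> P b \<Longrightarrow> P (a + b)"
    and g: "\<And>x a. P a \<Longrightarrow> P (gen x * a)"
  shows "P z"
proof (induction z rule: poly_mapping_sum_induct)
  case zero
  show ?case using s[of 0] by (simp add: scalar_def)
next
  case (monomial w c)
  have "P (Poly_Mapping.single (Word xs) c)" for xs
    by (induction xs) (auto simp: single_Nil single_Cons s g)
  then show ?case by (cases w) simp
qed (rule add)

lemma scalar_0 [simp]: "scalar 0 = 0"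
  and scalar_1 [simp]: "scalar 1 = 1"
  by (simp_all add: scalar_def)

lemma scalar_add: "scalar (a + b) = scalar a + scalar b"
  by (simp add: scalar_def single_add)

lemma scalar_mult: "scalar (a * b) = scalar a * scalar b"
  by (simp add: scalar_def mult_single)

lemma scalar_commute: "scalar c * z = z * scalar (c::'k::field)"
  by (induction z rule: poly_mapping_sum_induct)
     (simp_all add: scalar_def algebra_simps mult_single)

lemma scalar_left_commute: "z * (scalar c * w) = scalar c * (z * w)"
  for w :: "('a, 'k::field) free_algebra"
  by (simp only: mult.assoc[symmetric] scalar_commute[of c z])

lemma ideal_ring_of_classD:
  assumes "ideal I (ring_of_class :: 'r::ring_1 ring)"
  shows "0 \<in> I" "a \<in> I \<Longrightarrow> b \<in> I \<Longrightarrow> a + b \<in> I" "a \<in> I \<Longrightarrow> - a \<in> I"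
    "a \<in> I \<Longrightarrow> r * a \<in> I" "a \<in> I \<Longrightarrow> a * r \<in> I"
proof -
  interpret ideal I "ring_of_class :: 'r ring" by fact
  show "0 \<in> I" using additive_subgroup.zero_closed[OF is_additive_subgroup]
    by (simp add: ring_of_class_def)
  show "a \<in> I \<Longrightarrow> b \<in> I \<Longrightarrow> a + b \<in> I"
    using additive_subgroup.a_closed[OF is_additive_subgroup, of a b]
    by (simp add: ring_of_class_def)
  show l: "a \<in> I \<Longrightarrow> r * a \<in> I" for a r
    using I_l_closed[of a r] by (simp add: ring_of_class_def)
  show "a \<in> I \<Longrightarrow> a * r \<in> I"
    using I_r_closed[of a r] by (simp add: ring_of_class_def)
  show "a \<in> I \<Longrightarrow> - a \<in> I" using l[of a "-1"] by simp
qed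

lemma ideal_ring_of_classI:
  fixes I :: "'r::ring_1 set"
  assumes "0 \<in> I" "\<And>a b. a \<in> I \<Longrightarrow> b \<in> I \<Longrightarrow> a + b \<in> I"
    "\<And>a r. a \<in> I \<Longrightarrow> r * a \<in> I" "\<And>a r. a \<in> I \<Longrightarrow> a * r \<in> I"
  shows "ideal I ring_of_class"
proof (rule idealI)
  interpret ring "ring_of_class :: 'r ring" by (rule ring_ring_of_class)
  show "ring (ring_of_class :: 'r ring)" by (rule ring_ring_of_class)
  have neg: "\<ominus>\<^bsub>ring_of_class\<^esub> a \<in> I" if a: "a \<in> I" for a
  proof -
    have "\<ominus>\<^bsub>ring_of_class\<^esub> a = - a"
      by (rule minus_equality) (simp_all add: ring_of_class_def)
    then show ?thesis using assms(3)[OF a, of "-1"] by simp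
  qed
  show "subgroup I (add_monoid ring_of_class)"
    by (rule add.subgroupI)
       (use assms neg in \<open>auto simp: ring_of_class_def simp flip: a_inv_def\<close>)
qed (use assms in \<open>auto simp: ring_of_class_def\<close>)

text \<open>
  Primeness of the quotient becomes a statement about elements of the free algebra, so that cosets
  never have to be handled again.
\<close>

lemma prime_ring_quotient_iff:
  fixes I :: "'r::ring_1 set"
  assumes I: "ideal I ring_of_class"
  shows "prime_ring (ring_of_class Quot I) \<longleftrightarrow>
    1 \<notin> I \<and> (\<forall>a b. (\<forall>r. a * r * b \<in> I) \<longrightarrow> a \<in> I \<or> b \<in> I)"
proof -
  let ?F = "ring_of_class :: 'r ring" and ?Q = "ring_of_class Quot I"
  interpret ideal I ?F by (rule I)
  have F: "x \<in> carrier ?F" for x by (simp add: ring_of_class_def)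
  have F': "x \<otimes>\<^bsub>?F\<^esub> y = x * y" "\<one>\<^bsub>?F\<^esub> = 1" for x y by (simp_all add: ring_of_class_def)
  have zero: "\<zero>\<^bsub>?Q\<^esub> = I" by (simp add: FactRing_def)
  have one: "\<one>\<^bsub>?Q\<^esub> = I +>\<^bsub>?F\<^esub> 1" by (simp add: FactRing_def F')
  have mult: "(I +>\<^bsub>?F\<^esub> x) \<otimes>\<^bsub>?Q\<^esub> (I +>\<^bsub>?F\<^esub> y) = I +>\<^bsub>?F\<^esub> (x * y)" for x y
    using rcoset_mult_add[of x y] by (simp add: FactRing_def F F')
  have eqI: "I +>\<^bsub>?F\<^esub> x = I \<longleftrightarrow> x \<in> I" for x
    using F a_rcos_const a_rcos_self by metis
  have carr: "carrier ?Q = range (\<lambda>x. I +>\<^bsub>?F\<^esub> x)"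
    unfolding FactRing_def A_RCOSETS_def RCOSETS_def a_r_coset_def
    by (auto simp: ring_of_class_def)
  show ?thesis
    unfolding prime_ring_def zero one carr
    using quotient_is_ring by (simp add: mult eqI)
qed

section \<open>Polynomials in the central variables\<close>

definition mvar :: "'n \<Rightarrow> ('n, 'k::field) mpoly"
  where "mvar i = Poly_Mapping.single (Poly_Mapping.single i 1) 1"

definition t_monomial :: "('n::{finite,linorder} \<Rightarrow>\<^sub>0 nat) \<Rightarrow> ('n letter, 'k::field) free_algebra"
  where "t_monomial m =
    prod_list (map (\<lambda>i. gen (T i) ^ Poly_Mapping.lookup m i) (sorted_list_of_set UNIV))"

lemma mvar_power: "mvar i ^ k = (Poly_Mapping.single (Poly_Mapping.single i k) 1 :: ('n, 'k::field) mpoly)"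
  by (induction k) (simp_all add: mvar_def mult_single flip: single_add)

lemma prod_list_single:
  "prod_list (map (\<lambda>i. Poly_Mapping.single (g i) 1) xs) =
    (Poly_Mapping.single (sum_list (map g xs)) 1 :: 'm::comm_monoid_add \<Rightarrow>\<^sub>0 'k::field)"
  by (induction xs) (simp_all add: mult_single)

text \<open>
  \<open>t_monomial\<close> is a word in a fixed order; read in the commutative polynomial ring, it must give back
  the monomial with the same exponents.
\<close>

lemma prod_mvar_powers:
  fixes m :: "'n::{finite,linorder} \<Rightarrow>\<^sub>0 nat"
  shows "prod_list (map (\<lambda>i. mvar i ^ Poly_Mapping.lookup m i) (sorted_list_of_set UNIV)) =
    (Poly_Mapping.single m 1 :: ('n, 'k::field) mpoly)"
proof -
  have "sum_list (map (\<lambda>i. Poly_Mapping.single i (Poly_Mapping.lookup m i)) (sorted_list_of_set UNIV))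
      = (\<Sum>i\<in>UNIV. Poly_Mapping.single i (Poly_Mapping.lookup m i))"
    by (subst sum_list_distinct_conv_sum_set) simp_all
  also have "\<dots> = m"
    by (rule poly_mapping_eqI) (simp add: lookup_sum lookup_single when_def)
  finally show ?thesis by (simp add: mvar_power prod_list_single)
qed

lemma eval_t_superset:
  assumes "finite A" "Poly_Mapping.keys p \<subseteq> A"
  shows "eval_t p = (\<Sum>m\<in>A. scalar (Poly_Mapping.lookup p m) * t_monomial m)"
  unfolding eval_t_def t_monomial_def
  by (rule sum.mono_neutral_left) (use assms in \<open>auto simp: in_keys_iff\<close>)

lemma eval_t_add: "eval_t (p + q) = eval_t p + eval_t q"
proof -
  let ?A = "Poly_Mapping.keys p \<union> Poly_Mapping.keys q"
  have "Poly_Mapping.keys (p + q) \<subseteq> ?A" by (rule keys_add)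
  then show ?thesis
    by (simp add: eval_t_superset[of ?A] lookup_add scalar_add algebra_simps sum.distrib)
qed

lemma eval_t_single: "eval_t (Poly_Mapping.single m c) = scalar c * t_monomial m"
  by (subst eval_t_superset[of "{m}"]) simp_all

lemma t_monomial_0 [simp]: "t_monomial (0 :: 'n::{finite,linorder} \<Rightarrow>\<^sub>0 nat) = 1"
proof -
  have "prod_list (map (\<lambda>i. 1) xs) = (1 :: 'c::monoid_mult)" for xs :: "'n list"
    by (induction xs) simp_all
  then show ?thesis by (simp add: t_monomial_def)
qed

lemma eval_t_0 [simp]: "eval_t 0 = 0"
  by (simp add: eval_t_def)

lemma eval_t_const: "eval_t (Poly_Mapping.single 0 c) = scalar c"
  by (simp add: eval_t_single)

section \<open>Representations by weighted shifts\<close>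

text \<open>
  The coefficients of the representations: polynomials in two variables over \<open>k[t\<^sub>1, \<dots>, t\<^sub>n]\<close>. The
  outer variable, \<open>X = [:0, 1:]\<close>, is meant to be the eigenvalue of \<open>ud\<close> on a chosen basis vector, and
  the inner one, \<open>Y = [:[:0, 1:]:]\<close>, that of \<open>du\<close>.
\<close>

type_synonym ('n, 'k) coeff_ring = "('n, 'k) mpoly poly poly"

definition const :: "('n, 'k::field) mpoly \<Rightarrow> ('n, 'k) coeff_ring"
  where "const r = [:[:r:]:]"

lemma const_simps:
  "const 0 = 0" "const 1 = 1" "const (a + b) = const a + const b"
  "const (a * b) = const a * const b"
  by (simp_all add: const_def one_pCons)

lemma const_eq_0_iff [simp]: "const a = 0 \<longleftrightarrow> a = 0"
  by (simp add: const_def)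

definition sconst :: "'k::field \<Rightarrow> ('n, 'k) coeff_ring"
  where "sconst c = const (Poly_Mapping.single 0 c)"

lemma sconst_simps:
  "sconst 0 = 0" "sconst 1 = 1" "sconst (a + b) = sconst a + sconst b"
  "sconst (a * b) = sconst a * sconst b"
  by (simp_all add: sconst_def const_simps single_add mult_single flip: const_simps(4))

text \<open>
  If \<open>v\<^sub>n\<close> is the function that is 1 at \<open>n\<close> and 0 elsewhere, then \<open>u v\<^sub>n = \<mu>(n + 1) v\<^sub>n\<^sub>+\<^sub>1\<close> and
  \<open>d v\<^sub>n = \<nu>(n) v\<^sub>n\<^sub>-\<^sub>1\<close>. Hence \<open>ud\<close> has on \<open>v\<^sub>n\<close> the eigenvalue \<open>\<mu>(n) \<nu>(n)\<close>, its weight, and \<open>du\<close> the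
  next weight \<open>\<mu>(n + 1) \<nu>(n + 1)\<close>. Two families of factors are kept, rather than the weights alone,
  because a Verma module needs \<open>\<mu>(0) = 0\<close>, which cuts off the negative indices.
\<close>

primrec letter_act ::
  "(int \<Rightarrow> ('n, 'k::field) coeff_ring) \<Rightarrow> (int \<Rightarrow> ('n, 'k) coeff_ring) \<Rightarrow> 'n letter \<Rightarrow>
    (int \<Rightarrow> ('n, 'k) coeff_ring) \<Rightarrow> int \<Rightarrow> ('n, 'k) coeff_ring"
where
  "letter_act \<mu> \<nu> U f = (\<lambda>n. \<mu> n * f (n - 1))"
| "letter_act \<mu> \<nu> D f = (\<lambda>n. \<nu> (n + 1) * f (n + 1))"
| "letter_act \<mu> \<nu> (T i) f = (\<lambda>n. const (mvar i) * f n)"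

definition word_act where
  "word_act \<mu> \<nu> w f = foldr (letter_act \<mu> \<nu>) (letters w) f"

definition act ::
  "(int \<Rightarrow> ('n::{finite,linorder}, 'k::field) coeff_ring) \<Rightarrow> (int \<Rightarrow> ('n, 'k) coeff_ring) \<Rightarrow>
    ('n letter, 'k) free_algebra \<Rightarrow>
    (int \<Rightarrow> ('n, 'k) coeff_ring) \<Rightarrow> int \<Rightarrow> ('n, 'k) coeff_ring"
where
  "act \<mu> \<nu> z f = (\<lambda>n. \<Sum>w\<in>Poly_Mapping.keys z.
    sconst (Poly_Mapping.lookup z w) * word_act \<mu> \<nu> w f n)"

locale weighted_shifts =
  fixes \<mu> \<nu> :: "int \<Rightarrow> ('n::{finite,linorder}, 'k::field) coeff_ring"
begin

lemma act_superset:
  assumes "finite A" "Poly_Mapping.keys z \<subseteq> A"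
  shows "act \<mu> \<nu> z f n = (\<Sum>w\<in>A.
    sconst (Poly_Mapping.lookup z w) * word_act \<mu> \<nu> w f n)"
  unfolding act_def
  by (rule sum.mono_neutral_left) (use assms in \<open>auto simp: in_keys_iff sconst_simps\<close>)

lemma act_0 [simp]: "act \<mu> \<nu> 0 f = (\<lambda>n. 0)"
  by (simp add: act_def)

lemma act_add: "act \<mu> \<nu> (a + b) f = (\<lambda>n. act \<mu> \<nu> a f n + act \<mu> \<nu> b f n)"
proof
  fix n
  let ?A = "Poly_Mapping.keys a \<union> Poly_Mapping.keys b"
  have "Poly_Mapping.keys (a + b) \<subseteq> ?A" by (rule keys_add)
  then show "act \<mu> \<nu> (a + b) f n = act \<mu> \<nu> a f n + act \<mu> \<nu> b f n"
    by (simp add: act_superset[of ?A] lookup_add sconst_simps algebra_simps sum.distrib)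
qed

lemma act_single:
  "act \<mu> \<nu> (Poly_Mapping.single w c) f = (\<lambda>n. sconst c * word_act \<mu> \<nu> w f n)"
  by (simp add: fun_eq_iff act_superset[of "{w}"])

lemma word_act_0: "word_act \<mu> \<nu> w (\<lambda>n. 0) = (\<lambda>n. 0)"
  and word_act_add: "word_act \<mu> \<nu> w (\<lambda>n. f n + g n) = (\<lambda>n. word_act \<mu> \<nu> w f n + word_act \<mu> \<nu> w g n)"
  and word_act_smult: "word_act \<mu> \<nu> w (\<lambda>n. c * f n) = (\<lambda>n. c * word_act \<mu> \<nu> w f n)"
proof -
  have 0: "letter_act \<mu> \<nu> x (\<lambda>n. 0) = (\<lambda>n. 0)"
    "letter_act \<mu> \<nu> x (\<lambda>n. f n + g n) = (\<lambda>n. letter_act \<mu> \<nu> x f n + letter_act \<mu> \<nu> x g n)"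
    "letter_act \<mu> \<nu> x (\<lambda>n. c * f n) = (\<lambda>n. c * letter_act \<mu> \<nu> x f n)" for x f g
    by (cases x; simp add: algebra_simps)+
  have z: "foldr (letter_act \<mu> \<nu>) xs (\<lambda>n. 0) = (\<lambda>n. 0)" for xs
    by (induction xs) (simp_all add: 0)
  show "word_act \<mu> \<nu> w (\<lambda>n. 0) = (\<lambda>n. 0)"
    by (simp add: word_act_def z)
  have "foldr (letter_act \<mu> \<nu>) xs (\<lambda>n. f n + g n) =
    (\<lambda>n. foldr (letter_act \<mu> \<nu>) xs f n + foldr (letter_act \<mu> \<nu>) xs g n)" for xs
    by (induction xs) (simp_all add: 0)
  then show "word_act \<mu> \<nu> w (\<lambda>n. f n + g n) = (\<lambda>n. word_act \<mu> \<nu> w f n + word_act \<mu> \<nu> w g n)"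
    by (simp add: word_act_def)
  have "foldr (letter_act \<mu> \<nu>) xs (\<lambda>n. c * f n) = (\<lambda>n. c * foldr (letter_act \<mu> \<nu>) xs f n)" for xs
    by (induction xs) (simp_all add: 0)
  then show "word_act \<mu> \<nu> w (\<lambda>n. c * f n) = (\<lambda>n. c * word_act \<mu> \<nu> w f n)"
    by (simp add: word_act_def)
qed

lemma act_mult: "act \<mu> \<nu> (a * b) f = act \<mu> \<nu> a (act \<mu> \<nu> b f)"
proof (induction a rule: poly_mapping_sum_induct)
  case (add a a')
  then show ?case by (simp add: distrib_right act_add)
next
  case (monomial w c)
  show ?case
  proof (induction b rule: poly_mapping_sum_induct)
    case zero
    show ?case by (simp add: act_single word_act_0)
  next
    case (add b b')
    then show ?case by (simp add: distrib_left act_add act_single word_act_add)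
  next
    case (monomial w' c')
    have "word_act \<mu> \<nu> (w + w') f = word_act \<mu> \<nu> w (word_act \<mu> \<nu> w' f)"
      by (simp add: plus_free_monoid_def word_act_def)
    then show ?case
      by (simp add: mult_single act_single word_act_smult sconst_simps mult.assoc)
  qed
qed simp

lemma act_uminus: "act \<mu> \<nu> (- a) f = (\<lambda>n. - act \<mu> \<nu> a f n)"
  using act_add[of a "- a" f] by (simp add: fun_eq_iff add_eq_0_iff)

lemma act_diff: "act \<mu> \<nu> (a - b) f = (\<lambda>n. act \<mu> \<nu> a f n - act \<mu> \<nu> b f n)"
  using act_add[of a "- b" f] by (simp add: act_uminus)

lemma act_sum: "act \<mu> \<nu> (sum g A) f n = (\<Sum>i\<in>A. act \<mu> \<nu> (g i) f n)"
  by (induction A rule: infinite_finite_induct) (simp_all add: act_add)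

lemma act_scalar: "act \<mu> \<nu> (scalar c) f = (\<lambda>n. sconst c * f n)"
  by (simp add: scalar_def act_single word_act_def zero_free_monoid_def)

lemma act_1 [simp]: "act \<mu> \<nu> 1 f = f"
  using act_scalar[of 1 f] by (simp add: sconst_simps)

lemma act_gen: "act \<mu> \<nu> (gen x) f = letter_act \<mu> \<nu> x f"
  by (simp add: gen_def act_single word_act_def sconst_simps)

lemma act_U_power:
  "act \<mu> \<nu> (gen U ^ k) f n = (\<Prod>l<k. \<mu> (n - int l)) * f (n - int k)"
proof (induction k arbitrary: n)
  case (Suc k)
  have "(\<Prod>l<Suc k. \<mu> (n - int l)) = \<mu> n * (\<Prod>l<k. \<mu> (n - 1 - int l))"
    by (subst prod.lessThan_Suc_shift) (simp add: algebra_simps)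
  then show ?case by (simp add: act_mult act_gen Suc algebra_simps)
qed simp

lemma act_D_power:
  "act \<mu> \<nu> (gen D ^ k) f n = (\<Prod>l<k. \<nu> (n + 1 + int l)) * f (n + int k)"
proof (induction k arbitrary: n)
  case (Suc k)
  have "(\<Prod>l<Suc k. \<nu> (n + 1 + int l)) = \<nu> (n + 1) * (\<Prod>l<k. \<nu> (n + 1 + 1 + int l))"
    by (subst prod.lessThan_Suc_shift) (simp add: algebra_simps)
  then show ?case by (simp add: act_mult act_gen Suc algebra_simps)
qed simp

lemma act_t_monomial:
  "act \<mu> \<nu> (t_monomial m) f = (\<lambda>n. const (Poly_Mapping.single m 1) * f n)"
proof -
  have p: "act \<mu> \<nu> (gen (T i) ^ k) f = (\<lambda>n. const (mvar i ^ k) * f n)" for i k f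
    by (induction k) (simp_all add: act_mult act_gen const_simps mult.assoc)
  have "act \<mu> \<nu> (prod_list (map (\<lambda>i. gen (T i) ^ k i) xs)) f =
    (\<lambda>n. const (prod_list (map (\<lambda>i. mvar i ^ k i) xs)) * f n)" for k xs
    by (induction xs) (simp_all add: act_mult p const_simps mult.assoc)
  then show ?thesis by (simp add: t_monomial_def prod_mvar_powers)
qed

lemma act_eval_t: "act \<mu> \<nu> (eval_t p) f = (\<lambda>n. const p * f n)"
proof (induction p rule: poly_mapping_sum_induct)
  case (monomial m c)
  have "const (Poly_Mapping.single m c) =
      (sconst c * const (Poly_Mapping.single m 1) :: ('n, 'k) coeff_ring)"
    by (simp add: sconst_def mult_single flip: const_simps)
  then show ?case
    by (simp add: eval_t_single act_mult act_scalar act_t_monomial const_simps mult.assoc)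
qed (simp_all add: eval_t_add act_add const_simps algebra_simps)

end

definition relation_ideal where
  "relation_ideal \<alpha> \<beta> \<phi> = Idl\<^bsub>ring_of_class\<^esub> (relations \<alpha> \<beta> \<phi>)"

lemma ideal_relation_ideal: "ideal (relation_ideal \<alpha> \<beta> \<phi>) ring_of_class"
  unfolding relation_ideal_def
  by (intro ring.genideal_ideal ring_ring_of_class) (simp add: ring_of_class_def)

lemma relation_ideal_minimal:
  assumes "ideal I ring_of_class" "relations \<alpha> \<beta> \<phi> \<subseteq> I"
  shows "relation_ideal \<alpha> \<beta> \<phi> \<subseteq> I"
  unfolding relation_ideal_def by (rule ring.genideal_minimal[OF ring_ring_of_class assms])

lemma relations_in_ideal: "relations \<alpha> \<beta> \<phi> \<subseteq> relation_ideal \<alpha> \<beta> \<phi>"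
  unfolding relation_ideal_def
  by (rule ring.genideal_self[OF ring_ring_of_class]) (simp add: ring_of_class_def)

text \<open>
  Both defining relations, applied to a basis vector, become this recursion for the weights \<open>\<kappa>\<close>,
  multiplied by the factor with which the remaining \<open>d\<close> or \<open>u\<close> acts. Therefore the recursion may fail
  at an index where both factors vanish.
\<close>

definition weight_rec ::
  "'k \<Rightarrow> 'k \<Rightarrow> ('n, 'k::field) mpoly \<Rightarrow> (int \<Rightarrow> ('n, 'k) coeff_ring) \<Rightarrow> int \<Rightarrow> bool"
  where "weight_rec \<alpha> \<beta> \<phi> \<kappa> n \<longleftrightarrow>
    \<kappa> (n + 1) = sconst \<alpha> * \<kappa> n + sconst \<beta> * \<kappa> (n - 1) + const \<phi>"

lemma (in weighted_shifts) act_relation_ideal: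
  assumes \<mu>: "\<And>n. \<mu> n = 0 \<or> weight_rec \<alpha> \<beta> \<phi> (\<lambda>n. \<mu> n * \<nu> n) n"
    and \<nu>: "\<And>n. \<nu> n = 0 \<or> weight_rec \<alpha> \<beta> \<phi> (\<lambda>n. \<mu> n * \<nu> n) n"
    and z: "z \<in> relation_ideal \<alpha> \<beta> \<phi>"
  shows "act \<mu> \<nu> z f n = 0"
proof -
  let ?I = "{z. \<forall>f n. act \<mu> \<nu> z f n = 0}"
  note s = act_diff act_add act_mult act_gen act_scalar act_eval_t power2_eq_square
  have "ideal ?I ring_of_class"
  proof (rule ideal_ring_of_classI)
    fix a r assume a: "a \<in> ?I"
    then have "act \<mu> \<nu> a f = (\<lambda>n. 0)" for f by (simp add: fun_eq_iff)
    moreover have "act \<mu> \<nu> r (\<lambda>n. 0) = (\<lambda>n. 0)"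
      using act_mult[of r 0] by simp
    ultimately show "r * a \<in> ?I" by (simp add: act_mult)
    show "a * r \<in> ?I" using a by (simp add: act_mult)
  qed (simp_all add: act_add)
  moreover have "relations \<alpha> \<beta> \<phi> \<subseteq> ?I"
  proof -
    have "act \<mu> \<nu> (gen D ^ 2 * gen U - (scalar \<alpha> * (gen D * gen U * gen D) +
        scalar \<beta> * (gen U * gen D ^ 2) + eval_t \<phi> * gen D)) f n = 0" for f n
    proof -
      have "act \<mu> \<nu> (gen D ^ 2 * gen U - (scalar \<alpha> * (gen D * gen U * gen D) +
        scalar \<beta> * (gen U * gen D ^ 2) + eval_t \<phi> * gen D)) f n =
        (\<mu> (n+1+1) * \<nu> (n+1+1) - (sconst \<alpha> * (\<mu> (n+1) * \<nu> (n+1)) +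
         sconst \<beta> * (\<mu> (n+1-1) * \<nu> (n+1-1)) + const \<phi>)) * \<nu> (n + 1) * f (n + 1)"
        by (simp add: s algebra_simps)
      also have "\<dots> = 0" using \<nu>[of "n + 1"] by (auto simp: weight_rec_def)
      finally show ?thesis .
    qed
    moreover have "act \<mu> \<nu> (gen D * gen U ^ 2 - (scalar \<alpha> * (gen U * gen D * gen U) +
        scalar \<beta> * (gen U ^ 2 * gen D) + gen U * eval_t \<phi>)) f n = 0" for f n
    proof -
      have "act \<mu> \<nu> (gen D * gen U ^ 2 - (scalar \<alpha> * (gen U * gen D * gen U) +
        scalar \<beta> * (gen U ^ 2 * gen D) + gen U * eval_t \<phi>)) f n =
        (\<mu> (n+1) * \<nu> (n+1) - (sconst \<alpha> * (\<mu> n * \<nu> n) +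
         sconst \<beta> * (\<mu> (n-1) * \<nu> (n-1)) + const \<phi>)) * \<mu> n * f (n - 1)"
        by (simp add: s algebra_simps)
      also have "\<dots> = 0" using \<mu>[of n] by (auto simp: weight_rec_def)
      finally show ?thesis .
    qed
    moreover have "gen (T i) * gen x - gen x * gen (T i) \<in> ?I" for i x
      by (cases x) (simp_all add: s algebra_simps)
    ultimately show ?thesis
      unfolding relations_def Let_def by blast
  qed
  ultimately have "relation_ideal \<alpha> \<beta> \<phi> \<subseteq> ?I" by (rule relation_ideal_minimal)
  with z show ?thesis by auto
qed

section \<open>Calculation modulo the relations\<close>

text \<open>
  The value of a polynomial at \<open>y\<close>, in a ring that need not be commutative: the coefficients are mapped
  by \<open>h\<close> and stand to the right of the powers of \<open>y\<close>.
\<close>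

definition poly_at :: "('c::zero \<Rightarrow> 'r::ring_1) \<Rightarrow> 'r \<Rightarrow> 'c poly \<Rightarrow> 'r"
  where "poly_at h y f = fold_coeffs (\<lambda>a s. h a + y * s) f 0"

lemma poly_at_0 [simp]: "poly_at h y 0 = 0"
  by (simp add: poly_at_def)

lemma poly_at_pCons: "h 0 = 0 \<Longrightarrow> poly_at h y (pCons a f) = h a + y * poly_at h y f"
  by (cases "a = 0 \<and> f = 0") (auto simp: poly_at_def)

lemma poly_at_add:
  fixes h :: "'c::comm_monoid_add \<Rightarrow> 'r::ring_1"
  assumes "h 0 = 0" "\<And>a b. h (a + b) = h a + h b"
  shows "poly_at h y (f + g) = poly_at h y f + poly_at h y g"
proof (induction f g rule: poly_induct2)
  case (pCons a f b g)
  then show ?case by (simp add: poly_at_pCons assms algebra_simps)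
qed simp

locale down_up =
  fixes \<alpha> \<beta> :: "'k::field" and \<phi> :: "('n::{finite,linorder}, 'k) mpoly"
begin

abbreviation "J \<equiv> relation_ideal \<alpha> \<beta> \<phi>"
abbreviation u :: "('n letter, 'k) free_algebra" where "u \<equiv> gen U"
abbreviation d :: "('n letter, 'k) free_algebra" where "d \<equiv> gen D"
abbreviation t :: "'n \<Rightarrow> ('n letter, 'k) free_algebra" where "t i \<equiv> gen (T i)"
abbreviation x :: "('n letter, 'k) free_algebra" where "x \<equiv> u * d"
abbreviation y :: "('n letter, 'k) free_algebra" where "y \<equiv> d * u"

definition cong :: "('n letter, 'k) free_algebra \<Rightarrow> ('n letter, 'k) free_algebra \<Rightarrow> bool"
    (infix "\<approx>" 50)
  where "a \<approx> b \<longleftrightarrow> a - b \<in> J"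

lemmas J_closed = ideal_ring_of_classD[OF ideal_relation_ideal[of \<alpha> \<beta> \<phi>]]

lemma cong_refl [simp]: "a \<approx> a"
  by (simp add: cong_def J_closed)

lemma cong_sym: "a \<approx> b \<Longrightarrow> b \<approx> a"
  unfolding cong_def using J_closed(3)[of "a - b"] by simp

lemma cong_trans [trans]: "a \<approx> b \<Longrightarrow> b \<approx> c \<Longrightarrow> a \<approx> c"
  unfolding cong_def using J_closed(2)[of "a - b" "b - c"] by simp

lemma cong_add: "a \<approx> b \<Longrightarrow> a' \<approx> b' \<Longrightarrow> a + a' \<approx> b + b'"
  unfolding cong_def using J_closed(2)[of "a - b" "a' - b'"] by (simp add: algebra_simps)

lemma cong_mult_left: "a \<approx> b \<Longrightarrow> r * a \<approx> r * b"
  unfolding cong_def using J_closed(4)[of "a - b" r] by (simp add: algebra_simps)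

lemma cong_mult_right: "a \<approx> b \<Longrightarrow> a * r \<approx> b * r"
  unfolding cong_def using J_closed(5)[of "a - b" r] by (simp add: algebra_simps)

lemma cong_sum: "(\<And>j. j \<in> A \<Longrightarrow> f j \<approx> g j) \<Longrightarrow> sum f A \<approx> sum g A"
  by (induction A rule: infinite_finite_induct) (auto intro: cong_add)

lemma cong_0_iff: "a \<approx> 0 \<longleftrightarrow> a \<in> J"
  by (simp add: cong_def)

lemma cong_in_J: "a \<approx> b \<Longrightarrow> b \<in> J \<Longrightarrow> a \<in> J"
  using cong_trans[of a b 0] by (simp add: cong_0_iff)

lemma t_commutes_gen: "t i * gen z \<approx> gen z * t i"
proof -
  have "t i * gen z - gen z * t i \<in> relations \<alpha> \<beta> \<phi>"
    unfolding relations_def Let_def by (cases z) blast+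
  then show ?thesis unfolding cong_def using relations_in_ideal by blast
qed

text \<open>
  The elements \<open>x = ud\<close> and \<open>y = du\<close> are carried past \<open>d\<close> and \<open>u\<close> by the substitution \<open>\<sigma>\<close> with
  \<open>\<sigma>(x) = y\<close> and \<open>\<sigma>(y) = \<alpha>y + \<beta>x + \<phi>\<close>, namely \<open>d f = \<sigma>(f) d\<close> and \<open>f u = u \<sigma>(f)\<close>. The element \<open>twist\<close> is
  \<open>\<sigma>(y)\<close>.
\<close>

definition twist :: "('n letter, 'k) free_algebra"
  where "twist = scalar \<alpha> * y + scalar \<beta> * x + eval_t \<phi>"

lemma d_y: "d * y \<approx> twist * d"
proof -
  have "d\<^sup>2 * u - (scalar \<alpha> * (d * u * d) + scalar \<beta> * (u * d\<^sup>2) + eval_t \<phi> * d) \<in> J"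
    using relations_in_ideal[of \<alpha> \<beta> \<phi>] unfolding relations_def Let_def by blast
  then show ?thesis by (simp add: cong_def twist_def power2_eq_square algebra_simps)
qed

lemma y_u: "y * u \<approx> u * twist"
proof -
  have "d * u\<^sup>2 - (scalar \<alpha> * (u * d * u) + scalar \<beta> * (u\<^sup>2 * d) + u * eval_t \<phi>) \<in> J"
    using relations_in_ideal[of \<alpha> \<beta> \<phi>] unfolding relations_def Let_def by blast
  moreover have "u * (scalar \<alpha> * y + scalar \<beta> * x + eval_t \<phi>) =
      scalar \<alpha> * (u * d * u) + scalar \<beta> * (u\<^sup>2 * d) + u * eval_t \<phi>"
    by (simp add: distrib_left power2_eq_square mult.assoc scalar_left_commute[of u])
  ultimately show ?thesis by (simp add: cong_def twist_def power2_eq_square mult.assoc)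
qed

definition central :: "('n letter, 'k) free_algebra \<Rightarrow> bool"
  where "central c \<longleftrightarrow> (\<forall>z. c * z \<approx> z * c)"

lemma centralD: "central c \<Longrightarrow> c * z \<approx> z * c"
  by (simp add: central_def)

lemma central_scalar: "central (scalar c)"
  by (simp add: central_def scalar_commute)

lemma central_add: "central a \<Longrightarrow> central b \<Longrightarrow> central (a + b)"
  by (auto simp: central_def algebra_simps intro: cong_add)

lemma central_mult:
  assumes "central a" "central b" shows "central (a * b)"
  unfolding central_def
proof
  fix z
  have "a * b * z = a * (b * z)" by (simp add: mult.assoc)
  also have "\<dots> \<approx> a * (z * b)" by (intro cong_mult_left centralD assms)
  also have "\<dots> = a * z * b" by (simp add: mult.assoc)
  also have "\<dots> \<approx> z * a * b" by (intro cong_mult_right centralD assms)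
  finally show "a * b * z \<approx> z * (a * b)" by (simp add: mult.assoc)
qed

lemma central_1: "central 1"
  by (simp add: central_def)

lemma central_power: "central a \<Longrightarrow> central (a ^ k)"
  by (induction k) (simp_all add: central_1 central_mult)

lemma central_t: "central (t i)"
  unfolding central_def
proof
  fix z show "t i * z \<approx> z * t i"
  proof (induction z rule: free_algebra_left_induct)
    case (scalar c)
    show ?case by (simp add: scalar_commute)
  next
    case (add a b)
    then show ?case by (simp add: algebra_simps cong_add)
  next
    case (gen v a)
    have "t i * (gen v * a) \<approx> gen v * t i * a"
      unfolding mult.assoc[symmetric] by (intro cong_mult_right t_commutes_gen)
    also have "\<dots> = gen v * (t i * a)" by (simp add: mult.assoc)
    also have "\<dots> \<approx> gen v * (a * t i)" by (intro cong_mult_left gen)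
    finally show ?case by (simp add: mult.assoc)
  qed
qed

lemma central_eval_t: "central (eval_t \<psi>)"
proof (induction \<psi> rule: poly_mapping_sum_induct)
  case (monomial m c)
  have "central (prod_list (map (\<lambda>i. t i ^ k i) xs))" for k xs
    by (induction xs) (simp_all add: central_1 central_mult central_power central_t)
  then show ?case by (simp add: eval_t_single t_monomial_def central_mult central_scalar)
next
  case zero
  show ?case by (simp add: central_def)
qed (simp_all add: eval_t_add central_add)

text \<open>
  Centrality moves the new factor to its place in the ordered word. With it, evaluating a polynomial
  at the \<open>t\<^sub>i\<close> becomes compatible with multiplication by a variable.
\<close>

lemma t_mult_t_monomial: "t i * t_monomial m \<approx> t_monomial (Poly_Mapping.single i 1 + m)"
proof -
  have "t i * prod_list (map (\<lambda>j. t j ^ k j) xs) \<approx>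
      prod_list (map (\<lambda>j. t j ^ (if j = i then Suc (k j) else k j)) xs)"
    if "distinct xs" "i \<in> set xs" for k xs
    using that
  proof (induction xs)
    case (Cons j xs)
    show ?case
    proof (cases "j = i")
      case True
      with Cons.prems have "prod_list (map (\<lambda>j. t j ^ (if j = i then Suc (k j) else k j)) xs) =
          prod_list (map (\<lambda>j. t j ^ k j) xs)"
        by (intro arg_cong[of _ _ prod_list] map_cong) auto
      with True show ?thesis by (simp add: mult.assoc)
    next
      case False
      let ?P = "prod_list (map (\<lambda>j. t j ^ k j) xs)"
      have "t i * (t j ^ k j * ?P) = t i * t j ^ k j * ?P" by (simp add: mult.assoc)
      also have "\<dots> \<approx> t j ^ k j * t i * ?P" by (intro cong_mult_right centralD central_t)
      also have "\<dots> = t j ^ k j * (t i * ?P)" by (simp add: mult.assoc)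
      also have "\<dots> \<approx> t j ^ k j * prod_list (map (\<lambda>j. t j ^ (if j = i then Suc (k j) else k j)) xs)"
        using Cons False by (intro cong_mult_left) auto
      finally show ?thesis using False by simp
    qed
  qed simp
  from this[of "sorted_list_of_set UNIV" "Poly_Mapping.lookup m"]
  have "t i * t_monomial m \<approx> prod_list (map (\<lambda>j. t j ^ (if j = i then Suc (Poly_Mapping.lookup m j)
      else Poly_Mapping.lookup m j)) (sorted_list_of_set UNIV))"
    by (simp add: t_monomial_def)
  also have "(\<lambda>j. t j ^ (if j = i then Suc (Poly_Mapping.lookup m j) else Poly_Mapping.lookup m j)) =
     (\<lambda>j. t j ^ Poly_Mapping.lookup (Poly_Mapping.single i 1 + m) j)"
    by (auto simp: lookup_add lookup_single fun_eq_iff)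
  finally show ?thesis by (simp add: t_monomial_def)
qed

lemma scalar_mult_eval_t: "scalar c * eval_t p = eval_t (Poly_Mapping.single 0 c * p)"
proof (induction p rule: poly_mapping_sum_induct)
  case (monomial m a)
  then show ?case by (simp add: eval_t_single mult_single scalar_mult mult.assoc)
qed (simp_all add: eval_t_add distrib_left)

lemma t_mult_eval_t: "t i * eval_t p \<approx> eval_t (mvar i * p)"
proof (induction p rule: poly_mapping_sum_induct)
  case (monomial m a)
  have "t i * eval_t (Poly_Mapping.single m a) = scalar a * (t i * t_monomial m)"
    by (simp add: eval_t_single scalar_left_commute)
  also have "\<dots> \<approx> scalar a * t_monomial (Poly_Mapping.single i 1 + m)"
    by (intro cong_mult_left t_mult_t_monomial)
  also have "\<dots> = eval_t (mvar i * Poly_Mapping.single m a)"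
    by (simp add: mvar_def mult_single eval_t_single)
  finally show ?case .
next
  case (add p q)
  then show ?case by (simp add: eval_t_add distrib_left cong_add)
qed simp

section \<open>The diagonal subalgebra\<close>

text \<open>
  Modulo the relations, \<open>diag\<close> is the subalgebra generated by the \<open>t\<^sub>i\<close>, by \<open>y = du\<close> and, if
  \<open>\<beta> \<noteq> 0\<close>, by \<open>x = ud\<close>. It acts diagonally on weighted shift modules. For \<open>\<beta> = 0\<close> the element \<open>x\<close> is
  left out, because the normal form \<open>u\<^sup>i f(y) d\<^sup>k\<close> that serves in this case already contains \<open>x\<close> as the
  monomial with \<open>i = k = 1\<close>.
\<close>

definition diag_gens :: "('n letter, 'k) free_algebra set"
  where "diag_gens = range scalar \<union> range t \<union> {y} \<union> (if \<beta> = 0 then {} else {x})"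

inductive_set diag :: "('n letter, 'k) free_algebra set" where
  one: "1 \<in> diag"
| add: "p \<in> diag \<Longrightarrow> q \<in> diag \<Longrightarrow> p + q \<in> diag"
| gen: "g \<in> diag_gens \<Longrightarrow> p \<in> diag \<Longrightarrow> g * p \<in> diag"
| congr: "p \<in> diag \<Longrightarrow> p \<approx> q \<Longrightarrow> q \<in> diag"

lemma diag_mult: "p \<in> diag \<Longrightarrow> q \<in> diag \<Longrightarrow> p * q \<in> diag"
proof (induction rule: diag.induct)
  case (congr p p')
  then show ?case using diag.congr[OF _ cong_mult_right] by blast
qed (auto simp: mult.assoc distrib_right intro: diag.intros)

lemma diag_gens_subset: "g \<in> diag_gens \<Longrightarrow> g \<in> diag"
  using diag.gen[OF _ diag.one] by simp

lemma diag_scalar: "scalar c \<in> diag" and diag_t: "t i \<in> diag" and diag_y: "y \<in> diag" and diag_x: "\<beta> \<noteq> 0 \<Longrightarrow> x \<in> diag"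
  by (auto intro!: diag_gens_subset simp: diag_gens_def)

lemma diag_0: "0 \<in> diag"
  using diag_scalar[of 0] by simp

lemma diag_power: "p \<in> diag \<Longrightarrow> p ^ k \<in> diag"
  by (induction k) (auto intro: diag.one diag_mult)

lemma diag_eval_t: "eval_t \<psi> \<in> diag"
proof (induction \<psi> rule: poly_mapping_sum_induct)
  case (monomial m c)
  have "prod_list (map (\<lambda>i. t i ^ k i) xs) \<in> diag" for k xs
    by (induction xs) (simp_all add: diag.one diag_mult diag_power diag_t)
  then show ?case by (simp add: eval_t_single t_monomial_def diag_mult diag_scalar)
qed (simp_all add: eval_t_add diag.add diag_0)

text \<open>
  The coefficient of \<open>x\<close> in \<open>twist\<close> is \<open>\<beta>\<close>, so \<open>x\<close> occurs only when it is a generator.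
\<close>

lemma diag_twist: "twist \<in> diag"
proof -
  have "scalar \<beta> * x \<in> diag" using diag_0 diag_mult[OF diag_scalar diag_x] by (cases "\<beta> = 0") auto
  then show ?thesis unfolding twist_def by (intro diag.add diag_mult[OF diag_scalar diag_y] diag_eval_t)
qed

text \<open>
  A commutation rule for the generators extends to products, since each factor in turn is moved past
  \<open>a\<close>.
\<close>

lemma diag_shift_right:
  assumes g: "\<And>g. g \<in> diag_gens \<Longrightarrow> \<exists>q\<in>diag. g * a \<approx> a * q" and p: "p \<in> diag"
  shows "\<exists>q\<in>diag. p * a \<approx> a * q"
  using p
proof (induction rule: diag.induct)
  case one
  show ?case using diag.one by (intro bexI[of _ 1]) auto
next
  case (add p p')
  then obtain q q' where q: "q \<in> diag" "q' \<in> diag" "p * a \<approx> a * q" "p' * a \<approx> a * q'" by blast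
  then show ?case
    by (intro bexI[of _ "q + q'"]) (auto simp: algebra_simps intro: cong_add diag.add)
next
  case (gen h p)
  obtain q q' where q: "q \<in> diag" "q' \<in> diag" "h * a \<approx> a * q" "p * a \<approx> a * q'"
    using gen g by blast
  have "h * p * a = h * (p * a)" by (simp add: mult.assoc)
  also have "\<dots> \<approx> h * (a * q')" by (intro cong_mult_left q)
  also have "\<dots> = h * a * q'" by (simp add: mult.assoc)
  also have "\<dots> \<approx> a * q * q'" by (intro cong_mult_right q)
  finally show ?case using q by (intro bexI[of _ "q * q'"]) (auto simp: mult.assoc diag_mult)
next
  case (congr p p')
  then show ?case by (meson cong_mult_right cong_sym cong_trans)
qed

lemma diag_shift_left:
  assumes g: "\<And>g. g \<in> diag_gens \<Longrightarrow> \<exists>q\<in>diag. a * g \<approx> q * a" and p: "p \<in> diag"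
  shows "\<exists>q\<in>diag. a * p \<approx> q * a"
  using p
proof (induction rule: diag.induct)
  case one
  show ?case using diag.one by (intro bexI[of _ 1]) auto
next
  case (add p p')
  then obtain q q' where q: "q \<in> diag" "q' \<in> diag" "a * p \<approx> q * a" "a * p' \<approx> q' * a" by blast
  then show ?case
    by (intro bexI[of _ "q + q'"]) (auto simp: algebra_simps intro: cong_add diag.add)
next
  case (gen h p)
  obtain q q' where q: "q \<in> diag" "q' \<in> diag" "a * h \<approx> q * a" "a * p \<approx> q' * a"
    using gen g by blast
  have "a * (h * p) = a * h * p" by (simp add: mult.assoc)
  also have "\<dots> \<approx> q * a * p" by (intro cong_mult_right q)
  also have "\<dots> = q * (a * p)" by (simp add: mult.assoc)
  also have "\<dots> \<approx> q * (q' * a)" by (intro cong_mult_left q)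
  finally show ?case using q by (intro bexI[of _ "q * q'"]) (auto simp: mult.assoc diag_mult)
next
  case (congr p p')
  then show ?case by (meson cong_mult_left cong_sym cong_trans)
qed

lemma diag_shift_power:
  assumes s: "\<And>p. p \<in> diag \<Longrightarrow> \<exists>q\<in>diag. p * a \<approx> a * q" and p: "p \<in> diag"
  shows "\<exists>q\<in>diag. p * a ^ k \<approx> a ^ k * q"
  using p
proof (induction k arbitrary: p)
  case 0
  then show ?case by (auto intro: bexI[of _ p])
next
  case (Suc k)
  obtain q where q: "q \<in> diag" "p * a \<approx> a * q" using s Suc by blast
  obtain q' where q': "q' \<in> diag" "q * a ^ k \<approx> a ^ k * q'" using Suc q by blast
  have "p * a ^ Suc k = p * a * a ^ k" by (simp add: mult.assoc)
  also have "\<dots> \<approx> a * q * a ^ k" by (intro cong_mult_right q)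
  also have "\<dots> = a * (q * a ^ k)" by (simp add: mult.assoc)
  also have "\<dots> \<approx> a * (a ^ k * q')" by (intro cong_mult_left q')
  finally show ?case using q' by (auto simp: mult.assoc)
qed

lemma d_shift: "p \<in> diag \<Longrightarrow> \<exists>q\<in>diag. d * p \<approx> q * d"
proof (rule diag_shift_left)
  fix g assume "g \<in> diag_gens"
  then consider "central g" "g \<in> diag" | "g = y" | "g = x"
    unfolding diag_gens_def using central_scalar central_t diag_scalar diag_t by (auto split: if_splits)
  then show "\<exists>q\<in>diag. d * g \<approx> q * d"
  proof cases
    case 1
    then show ?thesis using centralD cong_sym by blast
  next
    case 2
    then show ?thesis using d_y diag_twist by blast
  next
    case 3
    show ?thesis by (rule bexI[of _ y]) (simp_all add: 3 mult.assoc diag_y)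
  qed
qed

lemma u_shift: "p \<in> diag \<Longrightarrow> \<exists>q\<in>diag. p * u \<approx> u * q"
proof (rule diag_shift_right)
  fix g assume "g \<in> diag_gens"
  then consider "central g" "g \<in> diag" | "g = y" | "g = x"
    unfolding diag_gens_def using central_scalar central_t diag_scalar diag_t by (auto split: if_splits)
  then show "\<exists>q\<in>diag. g * u \<approx> u * q"
  proof cases
    case 1
    then show ?thesis using centralD by blast
  next
    case 2
    then show ?thesis using y_u diag_twist by blast
  next
    case 3
    show ?thesis by (rule bexI[of _ y]) (simp_all add: 3 mult.assoc diag_y)
  qed
qed

text \<open>
  For \<open>\<beta> \<noteq> 0\<close> the substitution \<open>\<sigma>\<close> is invertible, with \<open>\<sigma>\<^sup>-\<^sup>1(y) = x\<close> and
  \<open>\<sigma>\<^sup>-\<^sup>1(x) = \<beta>\<^sup>-\<^sup>1 (y - \<alpha>x - \<phi>)\<close>, and diagonal elements can also be moved to the right of \<open>d\<close>.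
\<close>

lemma d_unshift:
  assumes \<beta>: "\<beta> \<noteq> 0"
  shows "p \<in> diag \<Longrightarrow> \<exists>q\<in>diag. p * d \<approx> d * q"
proof (rule diag_shift_right)
  fix g assume "g \<in> diag_gens"
  then consider "central g" "g \<in> diag" | "g = y" | "g = x"
    unfolding diag_gens_def using central_scalar central_t diag_scalar diag_t by (auto split: if_splits)
  then show "\<exists>q\<in>diag. g * d \<approx> d * q"
  proof cases
    case 1
    then show ?thesis using centralD by blast
  next
    case 2
    show ?thesis by (rule bexI[of _ x]) (simp_all add: 2 mult.assoc diag_x \<beta>)
  next
    case 3
    let ?b = "scalar (inverse \<beta>)"
    \<comment> \<open>the preimage of \<open>x\<close> under \<open>\<sigma>\<close>\<close>
    define q where "q = ?b * (y + scalar (-\<alpha>) * x + scalar (-1) * eval_t \<phi>)"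
    have q: "q \<in> diag"
      unfolding q_def by (intro diag_mult diag.add diag_scalar diag_y diag_x \<beta> diag_eval_t)
    have neg: "scalar (- c) = - scalar c" for c
      by (simp add: scalar_def single_uminus)
    have "d * q = ?b * (d * y + scalar (-\<alpha>) * (d * x) + scalar (-1) * (d * eval_t \<phi>))"
      unfolding q_def
      by (simp add: distrib_left mult.assoc scalar_left_commute[of d])
    also have "\<dots> \<approx> ?b * (twist * d + scalar (-\<alpha>) * (d * x) + scalar (-1) * (eval_t \<phi> * d))"
      by (intro cong_mult_left cong_add cong_refl d_y cong_sym[OF centralD] central_eval_t)
    also have "\<dots> = ?b * scalar \<beta> * (x * d)"
      by (simp add: twist_def neg algebra_simps)
    also have "?b * scalar \<beta> = 1" using \<beta> by (simp flip: scalar_mult)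
    finally have "d * q \<approx> x * d" by simp
    with 3 q show ?thesis using cong_sym by blast
  qed
qed

text \<open>
  The substitution \<open>X := ud\<close>, \<open>Y := du\<close>, \<open>t\<^sub>i := t\<^sub>i\<close>.
\<close>

definition coeff_eval :: "('n, 'k) coeff_ring \<Rightarrow> ('n letter, 'k) free_algebra"
  where "coeff_eval f = poly_at (poly_at eval_t y) x f"

lemma y_x_commute: "y * x \<approx> x * y"
proof -
  have "y * x = y * u * d" by (simp add: mult.assoc)
  also have "\<dots> \<approx> u * twist * d" by (intro cong_mult_right y_u)
  also have "\<dots> = u * (twist * d)" by (simp add: mult.assoc)
  also have "\<dots> \<approx> u * (d * y)" by (intro cong_mult_left cong_sym[OF d_y])
  finally show ?thesis by (simp add: mult.assoc)
qed

lemma mult_poly_at: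
  fixes h :: "'c::comm_ring_1 \<Rightarrow> ('n letter, 'k) free_algebra"
  assumes h: "h 0 = 0" "\<And>a. g * h a \<approx> h (c * a)" and g: "g * z \<approx> z * g"
  shows "g * poly_at h z f \<approx> poly_at h z (smult c f)"
proof (induction f)
  case (pCons a f)
  have "g * poly_at h z (pCons a f) = g * h a + g * z * poly_at h z f"
    by (simp add: poly_at_pCons h algebra_simps)
  also have "\<dots> \<approx> h (c * a) + z * g * poly_at h z f"
    by (intro cong_add h cong_mult_right g)
  also have "\<dots> = h (c * a) + z * (g * poly_at h z f)" by (simp add: mult.assoc)
  also have "\<dots> \<approx> h (c * a) + z * poly_at h z (smult c f)"
    by (intro cong_add cong_refl cong_mult_left pCons)
  finally show ?case by (simp add: poly_at_pCons h)
qed simp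

text \<open>
  Every diagonal element comes from a polynomial, in which \<open>X\<close> is absent if \<open>\<beta> = 0\<close>: multiplying by a
  generator of \<open>diag\<close> corresponds to multiplying the polynomial by a scalar, a \<open>t\<^sub>i\<close>, \<open>Y\<close> or \<open>X\<close>.
\<close>

lemma diag_coeff_eval:
  assumes "p \<in> diag"
  shows "\<exists>f. (\<beta> = 0 \<longrightarrow> degree f = 0) \<and> p \<approx> coeff_eval f"
  using assms
proof (induction rule: diag.induct)
  case one
  have "coeff_eval [:[:1:]:] = eval_t 1" by (simp add: coeff_eval_def poly_at_pCons)
  also have "\<dots> = 1" using eval_t_const[of 1] by simp
  finally show ?case by (intro exI[of _ "[:[:1:]:]"]) simp
next
  case (add p q)
  then obtain f g where fg: "\<beta> = 0 \<longrightarrow> degree f = 0" "\<beta> = 0 \<longrightarrow> degree g = 0"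
    "p \<approx> coeff_eval f" "q \<approx> coeff_eval g" by blast
  have "coeff_eval (f + g) = coeff_eval f + coeff_eval g"
    unfolding coeff_eval_def by (simp add: poly_at_add eval_t_add)
  with fg show ?case
    using degree_add_le[of f 0 g] by (intro exI[of _ "f + g"]) (auto intro: cong_add)
next
  case (congr p q)
  then show ?case using cong_sym cong_trans by blast
next
  case (gen g p)
  then obtain f where f: "\<beta> = 0 \<longrightarrow> degree f = 0" "p \<approx> coeff_eval f" by blast
  have gp: "g * p \<approx> g * coeff_eval f" by (intro cong_mult_left f)
  have smult: ?case if "g * coeff_eval f \<approx> coeff_eval (smult c f)" for c
    using f(1) degree_smult_le[of c f] cong_trans[OF gp that]
    by (intro exI[of _ "smult c f"]) auto
  have ce: ?case if g: "central g" "\<And>a. g * eval_t a \<approx> eval_t (c * a)" for c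
  proof (rule smult[of "[:c:]"], unfold coeff_eval_def, rule mult_poly_at)
    fix a show "g * poly_at eval_t y a \<approx> poly_at eval_t y ([:c:] * a)"
      using mult_poly_at[of eval_t g c y a] g centralD by simp
  qed (use g centralD in simp_all)
  from gen(1) consider c where "g = scalar c" | i where "g = t i" | "g = y" | "\<beta> \<noteq> 0" "g = x"
    by (auto simp: diag_gens_def split: if_splits)
  then show ?case
  proof cases
    case (1 c)
    then show ?thesis
      by (intro ce[of "Poly_Mapping.single 0 c"]) (simp_all add: central_scalar scalar_mult_eval_t)
  next
    case (2 i)
    then show ?thesis by (intro ce[of "mvar i"]) (simp_all add: central_t t_mult_eval_t)
  next
    case 3
    then show ?thesis
      by (intro smult[of "[:0, 1:]"], unfold coeff_eval_def)
         (intro mult_poly_at; simp add: y_x_commute poly_at_pCons)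
  next
    case 4
    have "x * coeff_eval f = coeff_eval (pCons 0 f)"
      by (simp add: coeff_eval_def poly_at_pCons)
    with 4 gp show ?thesis by (intro exI[of _ "pCons 0 f"]) simp
  qed
qed

section \<open>Spanning sets\<close>

text \<open>
  All elements that are, modulo the relations, a finite sum of terms \<open>L j * p * R j\<close> with diagonal
  coefficients \<open>p\<close> placed between the two outer factors.
\<close>

definition diag_span :: "('j \<Rightarrow> ('n letter, 'k) free_algebra) \<Rightarrow> ('j \<Rightarrow> ('n letter, 'k) free_algebra) \<Rightarrow>
    ('n letter, 'k) free_algebra set"
  where "diag_span L R = {z. \<exists>A f. finite A \<and> (\<forall>j\<in>A. f j \<in> diag) \<and> z \<approx> (\<Sum>j\<in>A. L j * f j * R j)}"

lemma diag_span_cong: "a \<approx> b \<Longrightarrow> b \<in> diag_span L R \<Longrightarrow> a \<in> diag_span L R"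
  unfolding diag_span_def using cong_trans by blast

lemma diag_span_base: "p \<in> diag \<Longrightarrow> L j * p * R j \<in> diag_span L R"
  unfolding diag_span_def by (intro CollectI exI[of _ "{j}"] exI[of _ "\<lambda>_. p"]) simp

lemma diag_span_0: "0 \<in> diag_span L R"
  unfolding diag_span_def by (intro CollectI exI[of _ "{}"]) simp

lemma diag_span_add:
  assumes "a \<in> diag_span L R" "b \<in> diag_span L R"
  shows "a + b \<in> diag_span L R"
proof -
  obtain A f B g where *: "finite A" "\<forall>j\<in>A. f j \<in> diag" "a \<approx> (\<Sum>j\<in>A. L j * f j * R j)"
    "finite B" "\<forall>j\<in>B. g j \<in> diag" "b \<approx> (\<Sum>j\<in>B. L j * g j * R j)"
    using assms unfolding diag_span_def by blast
  define f' where "f' j = (if j \<in> A then f j else 0)" for j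
  define g' where "g' j = (if j \<in> B then g j else 0)" for j
  have "(\<Sum>j\<in>A. L j * f j * R j) = (\<Sum>j\<in>A \<union> B. L j * f' j * R j)"
    by (rule sum.mono_neutral_cong_left) (use * in \<open>auto simp: f'_def\<close>)
  moreover have "(\<Sum>j\<in>B. L j * g j * R j) = (\<Sum>j\<in>A \<union> B. L j * g' j * R j)"
    by (rule sum.mono_neutral_cong_left) (use * in \<open>auto simp: g'_def\<close>)
  ultimately have "a + b \<approx> (\<Sum>j\<in>A \<union> B. L j * (f' j + g' j) * R j)"
    using cong_add[OF *(3,6)] by (simp add: algebra_simps sum.distrib)
  moreover have "f' j + g' j \<in> diag" for j
    using * diag_0 by (auto simp: f'_def g'_def intro: diag.add)
  ultimately show ?thesis
    unfolding diag_span_def using * by (intro CollectI exI[of _ "A \<union> B"] exI[of _ "\<lambda>j. f' j + g' j"]) auto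
qed

lemma diag_span_mult_left:
  assumes g: "\<And>j p. p \<in> diag \<Longrightarrow> g * (L j * p * R j) \<in> diag_span L R" and z: "z \<in> diag_span L R"
  shows "g * z \<in> diag_span L R"
proof -
  obtain A f where *: "finite A" "\<forall>j\<in>A. f j \<in> diag" "z \<approx> (\<Sum>j\<in>A. L j * f j * R j)"
    using z unfolding diag_span_def by blast
  have "(\<Sum>j\<in>A. g * (L j * f j * R j)) \<in> diag_span L R"
    using *(1,2) by induction (auto intro: diag_span_0 diag_span_add g)
  moreover have "g * z \<approx> (\<Sum>j\<in>A. g * (L j * f j * R j))"
    using cong_mult_left[OF *(3), of g] by (simp add: sum_distrib_left)
  ultimately show ?thesis by (rule diag_span_cong[rotated])
qed

lemma diag_span_central:
  assumes "central c" "c \<in> diag" "p \<in> diag"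
  shows "c * (L j * p * R j) \<in> diag_span L R"
proof (rule diag_span_cong)
  have "c * (L j * p * R j) = c * L j * (p * R j)" by (simp add: mult.assoc)
  also have "\<dots> \<approx> L j * c * (p * R j)" by (intro cong_mult_right centralD assms)
  finally show "c * (L j * p * R j) \<approx> L j * (c * p) * R j" by (simp add: mult.assoc)
  show "L j * (c * p) * R j \<in> diag_span L R" by (intro diag_span_base diag_mult assms)
qed

text \<open>
  The free algebra is generated from 1 by left multiplication with scalars and letters; of these,
  scalars and the \<open>t\<^sub>i\<close> are absorbed by the coefficients in every case.
\<close>

lemma diag_span_UNIV:
  assumes 1: "1 \<in> diag_span L R"
    and u: "\<And>j p. p \<in> diag \<Longrightarrow> u * (L j * p * R j) \<in> diag_span L R"
    and d: "\<And>j p. p \<in> diag \<Longrightarrow> d * (L j * p * R j) \<in> diag_span L R"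
  shows "z \<in> diag_span L R"
proof (induction z rule: free_algebra_left_induct)
  case (scalar c)
  have "scalar c * 1 \<in> diag_span L R"
    using diag_span_mult_left[OF diag_span_central[OF central_scalar diag_scalar] 1] .
  then show ?case by simp
next
  case (gen v z)
  have "gen v * (L j * p * R j) \<in> diag_span L R" if "p \<in> diag" for j p
  proof (cases v)
    case (T i)
    then show ?thesis using diag_span_central[OF central_t diag_t that] by simp
  qed (use u[OF that] d[OF that] in simp_all)
  then show ?case by (rule diag_span_mult_left) (use gen in auto)
qed (rule diag_span_add)

text \<open>
  Only terms with a coefficient outside \<open>J\<close> are kept, and an element outside \<open>J\<close> keeps at least one.
  The converse, that a form with at least one such term is nonzero, is the task of the representations.
\<close>

lemma diag_span_normal_form:
  assumes z: "z \<in> diag_span L R" "z \<notin> J"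
  shows "\<exists>A f. finite A \<and> A \<noteq> {} \<and> (\<forall>j\<in>A. f j \<in> diag \<and> f j \<notin> J) \<and>
    z \<approx> (\<Sum>j\<in>A. L j * f j * R j)"
proof -
  obtain A f where *: "finite A" "\<forall>j\<in>A. f j \<in> diag" "z \<approx> (\<Sum>j\<in>A. L j * f j * R j)"
    using z unfolding diag_span_def by blast
  let ?A = "{j\<in>A. f j \<notin> J}"
  have "(\<Sum>j\<in>A. L j * f j * R j) \<approx> (\<Sum>j\<in>A. if f j \<notin> J then L j * f j * R j else 0)"
  proof (rule cong_sum)
    fix j assume "j \<in> A"
    show "L j * f j * R j \<approx> (if f j \<notin> J then L j * f j * R j else 0)"
    proof (cases "f j \<in> J")
      case True
      then have "L j * f j * R j \<in> J" by (intro J_closed(5) J_closed(4))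
      with True show ?thesis by (simp add: cong_0_iff)
    qed simp
  qed
  also have "\<dots> = (\<Sum>j\<in>?A. L j * f j * R j)"
    using *(1) by (simp add: sum.inter_filter)
  finally have z': "z \<approx> (\<Sum>j\<in>?A. L j * f j * R j)" by (rule cong_trans[OF *(3)])
  have "?A \<noteq> {}"
  proof
    assume A: "?A = {}"
    have "z \<approx> 0" using z' unfolding A sum.empty .
    with z(2) show False by (simp add: cong_0_iff)
  qed
  show ?thesis
    by (intro exI[of _ ?A] exI[of _ f]) (use * z' \<open>?A \<noteq> {}\<close> in simp)
qed

text \<open>
  The letter \<open>d\<close> is absorbed by \<open>u\<^sup>i p d\<^sup>k\<close> as follows: for \<open>i = 0\<close> it moves past \<open>p\<close> and joins \<open>d\<^sup>k\<close>,
  and for \<open>i > 0\<close> it forms \<open>y = du\<close> with the first \<open>u\<close>, after which \<open>y\<close> moves past \<open>u\<^sup>i\<^sup>-\<^sup>1\<close> and joins \<open>p\<close>.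
\<close>

lemma monomial_span: "z \<in> diag_span (\<lambda>(i, k). u ^ i) (\<lambda>(i :: nat, k :: nat). d ^ k)"
proof (rule diag_span_UNIV)
  let ?S = "diag_span (\<lambda>(i, k). u ^ i) (\<lambda>(i :: nat, k :: nat). d ^ k)"
  have base: "u ^ i * p * d ^ k \<in> ?S" if "p \<in> diag" for i k p
    using diag_span_base[OF that, of "\<lambda>(i, k). u ^ i" "(i, k)" "\<lambda>(i, k). d ^ k"] by simp
  show "1 \<in> ?S" using base[OF diag.one, of 0 0] by simp
  fix j :: "nat \<times> nat" and p assume p: "p \<in> diag"
  obtain i k where j: "j = (i, k)" by (cases j)
  have "u * (u ^ i * p * d ^ k) \<in> ?S"
    using base[OF p, of "Suc i" k] by (simp add: mult.assoc)
  then show "u * ((case j of (i, k) \<Rightarrow> u ^ i) * p * (case j of (i, k) \<Rightarrow> d ^ k)) \<in> ?S"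
    by (simp add: j)
  have "d * (u ^ i * p * d ^ k) \<in> ?S"
  proof (cases i)
    case 0
    obtain q where q: "q \<in> diag" "d * p \<approx> q * d" using d_shift[OF p] by blast
    have "d * (p * d ^ k) = d * p * d ^ k" by (simp add: mult.assoc)
    also have "\<dots> \<approx> q * d * d ^ k" by (intro cong_mult_right q)
    finally have "d * (u ^ i * p * d ^ k) \<approx> q * d * d ^ k" by (simp add: 0)
    then show ?thesis
      by (rule diag_span_cong) (use base[OF q(1), of 0 "Suc k"] in \<open>simp_all add: mult.assoc\<close>)
  next
    case (Suc l)
    obtain q where q: "q \<in> diag" "y * u ^ l \<approx> u ^ l * q"
      using diag_shift_power[OF u_shift diag_y, where k = l] by blast
    have "d * (u ^ i * p * d ^ k) = y * u ^ l * (p * d ^ k)" by (simp add: Suc mult.assoc)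
    also have "\<dots> \<approx> u ^ l * q * (p * d ^ k)" by (intro cong_mult_right q)
    finally show ?thesis
      by (rule diag_span_cong) (use base[OF diag_mult[OF q(1) p], of l k] in \<open>simp add: mult.assoc\<close>)
  qed
  then show "d * ((case j of (i, k) \<Rightarrow> u ^ i) * p * (case j of (i, k) \<Rightarrow> d ^ k)) \<in> ?S"
    by (simp add: j)
qed

text \<open>
  The monomial in \<open>u\<close> or \<open>d\<close> alone that raises the index of basis vectors by \<open>e\<close>.
\<close>

definition signed_power :: "int \<Rightarrow> ('n letter, 'k) free_algebra"
  where "signed_power e = (if e \<ge> 0 then u ^ nat e else d ^ nat (- e))"

text \<open>
  When \<open>\<sigma>\<close> is invertible, a \<open>u\<close> that meets a \<open>d\<close> forms \<open>x\<close>, which can be moved away to the right, and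
  therefore no mixed monomials remain.
\<close>

lemma signed_power_span:
  assumes \<beta>: "\<beta> \<noteq> 0"
  shows "z \<in> diag_span signed_power (\<lambda>_. 1)"
proof (rule diag_span_UNIV)
  let ?S = "diag_span signed_power (\<lambda>_. 1)"
  have base: "signed_power e * p \<in> ?S" if "p \<in> diag" for e p
    using diag_span_base[OF that, of signed_power e "\<lambda>_. 1"] by simp
  show "1 \<in> ?S" using base[OF diag.one, of 0] by (simp add: signed_power_def)
  fix e p assume p: "p \<in> diag"
  have "u * (signed_power e * p) \<in> ?S"
  proof (cases "e \<ge> 0")
    case True
    then have "u * signed_power e = signed_power (e + 1)"
      by (simp add: signed_power_def nat_add_distrib)
    then show ?thesis using base[OF p, of "e + 1"] by (simp flip: mult.assoc)
  next
    case False
    define k where "k = nat (- e - 1)"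
    with False have e: "e = - int (Suc k)" by (simp add: k_def)
    have w: "signed_power (e + 1) = d ^ k" by (simp add: signed_power_def e)
    have w': "signed_power e = d * d ^ k" by (simp add: signed_power_def e nat_add_distrib)
    obtain q where q: "q \<in> diag" "x * d ^ k \<approx> d ^ k * q"
      using diag_shift_power[OF d_unshift[OF \<beta>] diag_x[OF \<beta>], where k = k] by blast
    have "u * (signed_power e * p) = x * d ^ k * p" by (simp add: w' mult.assoc)
    also have "\<dots> \<approx> d ^ k * q * p" by (intro cong_mult_right q)
    finally show ?thesis
      by (rule diag_span_cong) (use base[OF diag_mult[OF q(1) p], of "e + 1"] in \<open>simp add: w mult.assoc\<close>)
  qed
  then show "u * (signed_power e * p * 1) \<in> ?S" by simp
  have "d * (signed_power e * p) \<in> ?S"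
  proof (cases "e \<le> 0")
    case True
    define k where "k = nat (- e)"
    with True have e: "e = - int k" by (simp add: k_def)
    have "d * signed_power e = signed_power (e - 1)"
      by (auto simp: signed_power_def e nat_add_distrib)
    then show ?thesis using base[OF p, of "e - 1"] by (simp flip: mult.assoc)
  next
    case False
    define k where "k = nat (e - 1)"
    with False have e: "e = int (Suc k)" by (simp add: k_def)
    have w: "signed_power (e - 1) = u ^ k" by (simp add: signed_power_def e)
    have w': "signed_power e = u * u ^ k" by (simp add: signed_power_def e nat_add_distrib)
    obtain q where q: "q \<in> diag" "y * u ^ k \<approx> u ^ k * q"
      using diag_shift_power[OF u_shift diag_y, where k = k] by blast
    have "d * (signed_power e * p) = y * u ^ k * p" by (simp add: w' mult.assoc)
    also have "\<dots> \<approx> u ^ k * q * p" by (intro cong_mult_right q)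
    finally show ?thesis
      by (rule diag_span_cong) (use base[OF diag_mult[OF q(1) p], of "e - 1"] in \<open>simp add: w mult.assoc\<close>)
  qed
  then show "d * (signed_power e * p * 1) \<in> ?S" by simp
qed

end

section \<open>Weighted shifts that detect the diagonal subalgebra\<close>

text \<open>
  Weighted shift representations of the algebra in which \<open>x\<close> and \<open>y\<close> act on \<open>v\<^sub>0\<close> as independent
  variables, with \<open>x\<close> considered only if it belongs to the generators of \<open>diag\<close>.
\<close>

locale down_up_shifts = down_up \<alpha> \<beta> \<phi> + weighted_shifts \<mu> \<nu>
  for \<alpha> \<beta> :: "'k::field" and \<phi> :: "('n::{finite,linorder}, 'k) mpoly"
    and \<mu> \<nu> :: "int \<Rightarrow> ('n, 'k) coeff_ring" +
  assumes rec_\<mu>: "\<And>n. \<mu> n = 0 \<or> weight_rec \<alpha> \<beta> \<phi> (\<lambda>n. \<mu> n * \<nu> n) n"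
    and rec_\<nu>: "\<And>n. \<nu> n = 0 \<or> weight_rec \<alpha> \<beta> \<phi> (\<lambda>n. \<mu> n * \<nu> n) n"
    and weight_1: "\<mu> 1 * \<nu> 1 = [:[:0, 1:]:]"
    and weight_0: "\<beta> \<noteq> 0 \<Longrightarrow> \<mu> 0 * \<nu> 0 = [:0, 1:]"
begin

lemma act_J: "z \<in> J \<Longrightarrow> act \<mu> \<nu> z f n = 0"
  by (rule act_relation_ideal[OF rec_\<mu> rec_\<nu>])

lemma act_cong: "a \<approx> b \<Longrightarrow> act \<mu> \<nu> a = act \<mu> \<nu> b"
  using act_J[of "a - b"] by (simp add: cong_def fun_eq_iff act_diff)

lemma act_x: "act \<mu> \<nu> x f n = \<mu> n * \<nu> n * f n"
  and act_y: "act \<mu> \<nu> y f n = \<mu> (n + 1) * \<nu> (n + 1) * f n"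
  by (simp_all add: act_mult act_gen)

lemma diag_acts_diagonally: "p \<in> diag \<Longrightarrow> \<exists>c. \<forall>f n. act \<mu> \<nu> p f n = c n * f n"
proof (induction rule: diag.induct)
  case one
  show ?case by (rule exI[of _ "\<lambda>_. 1"]) simp
next
  case (add p q)
  then obtain b c where "\<forall>f n. act \<mu> \<nu> p f n = b n * f n" "\<forall>f n. act \<mu> \<nu> q f n = c n * f n"
    by blast
  then show ?case by (intro exI[of _ "\<lambda>n. b n + c n"]) (simp add: act_add algebra_simps)
next
  case (gen g p)
  then obtain c where c: "\<forall>f n. act \<mu> \<nu> p f n = c n * f n" by blast
  consider a where "g = scalar a" | i where "g = t i" | "g = y" | "g = x"
    using gen(1) by (auto simp: diag_gens_def split: if_splits)
  then have "\<exists>b. \<forall>f n. act \<mu> \<nu> g f n = b n * f n"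
  proof cases
    case (1 a)
    then show ?thesis
      by (intro exI[of _ "\<lambda>n. sconst a"]) (simp add: act_scalar)
  next
    case (2 i)
    then show ?thesis by (intro exI[of _ "\<lambda>n. const (mvar i)"]) (simp add: act_gen)
  next
    case 3
    then show ?thesis by (intro exI[of _ "\<lambda>n. \<mu> (n + 1) * \<nu> (n + 1)"]) (simp add: act_y)
  next
    case 4
    then show ?thesis by (intro exI[of _ "\<lambda>n. \<mu> n * \<nu> n"]) (simp add: act_x)
  qed
  then obtain b where "\<forall>f n. act \<mu> \<nu> g f n = b n * f n" by blast
  with c show ?case by (intro exI[of _ "\<lambda>n. b n * c n"]) (simp add: act_mult mult.assoc)
next
  case (congr p q)
  then show ?case by (simp add: act_cong)
qed

lemma act_coeff_eval_at_0:
  assumes "\<beta> = 0 \<longrightarrow> degree g = 0"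
  shows "act \<mu> \<nu> (coeff_eval g) f 0 = g * f 0"
proof -
  have inner: "act \<mu> \<nu> (poly_at eval_t y a) f 0 = [:a:] * f 0" for a
  proof (induction a)
    case (pCons a s)
    have "[:pCons a s:] = const a + [:[:0, 1:]:] * [:s:]" by (simp add: const_def)
    moreover have "act \<mu> \<nu> (y * poly_at eval_t y s) f 0 = [:[:0, 1:]:] * ([:s:] * f 0)"
      unfolding act_mult[of y] act_y using pCons by (simp only: weight_1 add_0)
    ultimately show ?case
      by (simp only: poly_at_pCons eval_t_0 act_add act_eval_t distrib_right mult.assoc)
  qed simp
  show ?thesis
  proof (cases "\<beta> = 0")
    case True
    with assms obtain a where "g = [:a:]" by (metis degree_eq_zeroE)
    then show ?thesis by (simp add: coeff_eval_def poly_at_pCons inner)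
  next
    case False
    have "act \<mu> \<nu> (poly_at (poly_at eval_t y) x g) f 0 = g * f 0"
    proof (induction g)
      case (pCons a g)
      have "act \<mu> \<nu> (x * poly_at (poly_at eval_t y) x g) f 0 = [:0, 1:] * (g * f 0)"
        unfolding act_mult[of x] act_x using pCons by (simp only: weight_0[OF False])
      then have "act \<mu> \<nu> (poly_at (poly_at eval_t y) x (pCons a g)) f 0 =
          [:a:] * f 0 + [:0, 1:] * (g * f 0)"
        by (simp only: poly_at_pCons poly_at_0 act_add inner)
      also have "\<dots> = ([:a:] + [:0, 1:] * g) * f 0" by (simp only: distrib_right mult.assoc)
      also have "[:a:] + [:0, 1:] * g = pCons a g" by simp
      finally show ?case .
    qed simp
    then show ?thesis by (simp add: coeff_eval_def)
  qed
qed

text \<open>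
  A diagonal element is a polynomial in \<open>x\<close>, \<open>y\<close> and the \<open>t\<^sub>i\<close>, and its eigenvalue on \<open>v\<^sub>0\<close> is that same
  polynomial in the variables \<open>X\<close>, \<open>Y\<close> and \<open>t\<^sub>i\<close>. If the eigenvalue vanishes, then so does the
  polynomial, and the element lies in \<open>J\<close>.
\<close>

lemma diag_act_nonzero_at_0:
  assumes "p \<in> diag" "p \<notin> J"
  shows "\<exists>c. c 0 \<noteq> 0 \<and> (\<forall>f n. act \<mu> \<nu> p f n = c n * f n)"
proof -
  obtain g where g: "\<beta> = 0 \<longrightarrow> degree g = 0" "p \<approx> coeff_eval g"
    using diag_coeff_eval assms by blast
  obtain c where c: "\<forall>f n. act \<mu> \<nu> p f n = c n * f n" using diag_acts_diagonally assms by blast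
  have "g \<noteq> 0"
  proof
    assume "g = 0"
    with g have "p \<approx> 0" by (simp add: coeff_eval_def)
    with assms show False by (simp add: cong_0_iff)
  qed
  moreover have "c 0 = g"
    using c act_coeff_eval_at_0[OF g(1), of "\<lambda>_. 1"] act_cong[OF g(2)] by (metis mult.right_neutral)
  ultimately show ?thesis using c by blast
qed

lemma act_diag_span:
  assumes "z \<in> diag_span L R" "z \<notin> J"
  shows "\<exists>A c. finite A \<and> A \<noteq> {} \<and> (\<forall>j\<in>A. c j 0 \<noteq> 0) \<and> (\<forall>f n. act \<mu> \<nu> z f n =
    (\<Sum>j\<in>A. act \<mu> \<nu> (L j) (\<lambda>n. c j n * act \<mu> \<nu> (R j) f n) n))"
proof -
  obtain A p where A: "finite A" "A \<noteq> {}" and p: "\<forall>j\<in>A. p j \<in> diag \<and> p j \<notin> J"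
    and z: "z \<approx> (\<Sum>j\<in>A. L j * p j * R j)"
    using diag_span_normal_form[OF assms] by blast
  have "\<forall>j\<in>A. \<exists>c. c 0 \<noteq> 0 \<and> (\<forall>f n. act \<mu> \<nu> (p j) f n = c n * f n)"
    using diag_act_nonzero_at_0 p by blast
  then obtain c where c: "\<forall>j\<in>A. c j 0 \<noteq> 0 \<and> (\<forall>f n. act \<mu> \<nu> (p j) f n = c j n * f n)"
    by (auto dest!: bchoice)
  have pc: "act \<mu> \<nu> (p j) f = (\<lambda>n. c j n * f n)" if "j \<in> A" for j f
    using c that by (simp add: fun_eq_iff)
  have "act \<mu> \<nu> z f n = (\<Sum>j\<in>A. act \<mu> \<nu> (L j) (\<lambda>n. c j n * act \<mu> \<nu> (R j) f n) n)" for f n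
    unfolding act_cong[OF z] act_sum by (rule sum.cong) (simp_all add: act_mult pc)
  with A c show ?thesis by blast
qed

end

section \<open>Primeness for nonzero \<open>\<beta>\<close>\<close>

locale two_sided_shifts = down_up_shifts +
  assumes \<beta>_nonzero: "\<beta> \<noteq> 0" and \<mu>_1: "\<And>n. \<mu> n = 1" and \<nu>_nonzero: "\<And>n. \<nu> n \<noteq> 0"
begin

lemma act_signed_power: "\<exists>c. (\<forall>n. c n \<noteq> 0) \<and> (\<forall>f n. act \<mu> \<nu> (signed_power e) f n = c n * f (n - e))"
proof (cases "e \<ge> 0")
  case True
  then show ?thesis
    by (intro exI[of _ "\<lambda>_. 1"]) (simp add: signed_power_def act_U_power \<mu>_1)
next
  case False
  then show ?thesis
    by (intro exI[of _ "\<lambda>n. \<Prod>l<nat (- e). \<nu> (n + 1 + int l)"])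
       (simp add: signed_power_def act_D_power \<nu>_nonzero)
qed

text \<open>
  Let \<open>e\<close> be the largest exponent in the form \<open>\<Sum> w\<^sub>e p\<^sub>e\<close> of \<open>a\<close>, with \<open>w\<^sub>e\<close> the signed power. The
  component of the image at \<open>e\<close> can only come from the term \<open>w\<^sub>e p\<^sub>e\<close> applied to the topmost component
  of the argument, which sits at \<open>0\<close>; there \<open>p\<^sub>e\<close> has a nonzero eigenvalue.
\<close>

lemma leading_term:
  assumes "a \<notin> J"
  shows "\<exists>e. \<forall>f. f 0 \<noteq> 0 \<longrightarrow> (\<forall>n>0. f n = 0) \<longrightarrow>
    act \<mu> \<nu> a f e \<noteq> 0 \<and> (\<forall>n>e. act \<mu> \<nu> a f n = 0)"
proof -
  obtain A c where A: "finite A" "A \<noteq> {}" and c: "\<forall>j\<in>A. c j 0 \<noteq> 0"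
    and act: "\<forall>f n. act \<mu> \<nu> a f n = (\<Sum>j\<in>A. act \<mu> \<nu> (signed_power j) (\<lambda>n. c j n * act \<mu> \<nu> 1 f n) n)"
    using act_diag_span[OF signed_power_span[OF \<beta>_nonzero] assms] by blast
  obtain w where w: "\<And>e n. w e n \<noteq> 0"
    "\<And>e f n. act \<mu> \<nu> (signed_power e) f n = w e n * f (n - e)"
    using act_signed_power by metis
  have act': "act \<mu> \<nu> a f n = (\<Sum>j\<in>A. w j n * (c j (n - j) * f (n - j)))" for f n
    by (simp add: act w)
  show ?thesis
  proof (rule exI[of _ "Max A"], intro conjI allI impI)
    fix f :: "int \<Rightarrow> ('b, 'a) coeff_ring" assume f0: "f 0 \<noteq> 0" and f: "\<forall>n>0. f n = 0"
    have "act \<mu> \<nu> a f (Max A) = (\<Sum>j\<in>{Max A}. w j (Max A) * (c j (Max A - j) * f (Max A - j)))"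
      unfolding act' by (rule sum.mono_neutral_right)
        (use A f in \<open>auto simp: order_less_le\<close>)
    then show "act \<mu> \<nu> a f (Max A) \<noteq> 0" using A w c f0 by simp
    fix n assume "n > Max A"
    then have "f (n - j) = 0" if "j \<in> A" for j
      using f Max_ge[OF A(1) that] by simp
    then show "act \<mu> \<nu> a f n = 0" unfolding act' by simp
  qed
qed

text \<open>
  Applied to \<open>v\<^sub>0\<close>, the element \<open>b\<close> gives a function with a topmost component, at \<open>e'\<close> say. The signed
  power of exponent \<open>- e'\<close> shifts this component to \<open>0\<close> and multiplies it by a nonzero factor, and then
  \<open>leading_term\<close> applies to \<open>a\<close>.
\<close>

lemma prime_ideal:
  assumes "a \<notin> J" "b \<notin> J"
  shows "\<exists>r. a * r * b \<notin> J"
proof -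
  obtain e where e: "\<forall>f. f 0 \<noteq> 0 \<longrightarrow> (\<forall>n>0. f n = 0) \<longrightarrow>
    act \<mu> \<nu> a f e \<noteq> 0 \<and> (\<forall>n>e. act \<mu> \<nu> a f n = 0)"
    using leading_term[OF assms(1)] by blast
  obtain e' where e': "\<forall>f. f 0 \<noteq> 0 \<longrightarrow> (\<forall>n>0. f n = 0) \<longrightarrow>
    act \<mu> \<nu> b f e' \<noteq> 0 \<and> (\<forall>n>e'. act \<mu> \<nu> b f n = 0)"
    using leading_term[OF assms(2)] by blast
  define f where "f n = (if n = (0::int) then 1 else 0 :: ('b, 'a) coeff_ring)" for n
  define g where "g = act \<mu> \<nu> b f"
  have g: "g e' \<noteq> 0" "n > e' \<Longrightarrow> g n = 0" for n
    using e'[rule_format, of f] by (auto simp: g_def f_def)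
  obtain c where c: "\<And>n. c n \<noteq> 0" "\<And>f n. act \<mu> \<nu> (signed_power (- e')) f n = c n * f (n + e')"
    using act_signed_power[of "- e'"] by auto
  have "act \<mu> \<nu> a (act \<mu> \<nu> (signed_power (- e')) g) e \<noteq> 0"
    using e[rule_format, of "act \<mu> \<nu> (signed_power (- e')) g"] g c by simp
  then have "act \<mu> \<nu> (a * signed_power (- e') * b) f e \<noteq> 0"
    by (simp add: act_mult g_def)
  then show ?thesis using act_J by blast
qed

end

section \<open>Primeness for \<open>\<beta> = 0\<close>\<close>

text \<open>
  The basis vectors \<open>v\<^sub>0, v\<^sub>1, \<dots>\<close> span a Verma module with lowest vector \<open>v\<^sub>0\<close>: it is killed by \<open>d\<close>, every
  \<open>v\<^sub>n\<close> is \<open>u\<^sup>n v\<^sub>0\<close>, and \<open>d\<^sup>n v\<^sub>n\<close> is a nonzero multiple of \<open>v\<^sub>0\<close>.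
\<close>

locale verma_shifts = down_up_shifts +
  assumes \<mu>_def: "\<And>n. \<mu> n = (if n \<ge> 1 then 1 else 0)"
    and \<nu>_0: "\<nu> 0 = 0" and \<nu>_nonzero: "\<And>n. n \<ge> 1 \<Longrightarrow> \<nu> n \<noteq> 0"
begin

text \<open>
  Let \<open>k\<close> be the least exponent of \<open>d\<close> in the form \<open>\<Sum> u\<^sup>i p d\<^sup>k\<close> of \<open>a\<close>. On \<open>v\<^sub>k\<close> all terms with a
  larger exponent vanish, since \<open>d\<^sup>k\<^sup>+\<^sup>1 v\<^sub>k = 0\<close>. A term with exponent \<open>k\<close> sends \<open>v\<^sub>k\<close> to a multiple of
  \<open>v\<^sub>0\<close>, then to a nonzero multiple of \<open>v\<^sub>0\<close>, and finally to a multiple of \<open>v\<^sub>i\<close>; the \<open>v\<^sub>i\<close> are different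
  for different terms and cannot cancel. The number \<open>i\<close> in the conclusion is the largest one.
\<close>

lemma nonzero_on_basis_vector:
  assumes "a \<notin> J"
  shows "\<exists>k i :: nat. \<forall>f. f (int k) \<noteq> 0 \<longrightarrow> (\<forall>n. n \<noteq> int k \<longrightarrow> f n = 0) \<longrightarrow>
    act \<mu> \<nu> a f (int i) \<noteq> 0 \<and> (\<forall>n. n < 0 \<or> n > int i \<longrightarrow> act \<mu> \<nu> a f n = 0)"
proof -
  obtain A c where A: "finite A" "A \<noteq> {}" and c: "\<forall>j\<in>A. c j 0 \<noteq> 0"
    and act: "\<forall>f n. act \<mu> \<nu> a f n = (\<Sum>j\<in>A. act \<mu> \<nu> (case j of (i, k) \<Rightarrow> u ^ i)
        (\<lambda>n. c j n * act \<mu> \<nu> (case j of (i :: nat, k :: nat) \<Rightarrow> d ^ k) f n) n)"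
    using act_diag_span[OF monomial_span assms] by blast
  define k where "k = Min (snd ` A)"
  have k: "k \<in> snd ` A" "\<And>i l. (i, l) \<in> A \<Longrightarrow> k \<le> l"
  proof -
    show "k \<in> snd ` A" unfolding k_def using A by (intro Min_in) auto
    show "k \<le> l" if "(i, l) \<in> A" for i l
      unfolding k_def using A that by (intro Min_le) force+
  qed
  define I where "I = {i. (i, k) \<in> A}"
  have "I \<subseteq> fst ` A" by (force simp: I_def)
  then have I: "finite I" "I \<noteq> {}" using A(1) k(1) by (auto simp: I_def dest: finite_subset)
  define w where "w = (\<Prod>l<k. \<nu> (1 + int l))"
  have w: "w \<noteq> 0" by (simp add: w_def \<nu>_nonzero)
  have "act \<mu> \<nu> a f n = (if n \<ge> 0 \<and> nat n \<in> I then c (nat n, k) 0 * w * f (int k) else 0)"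
    if f: "\<forall>n. n \<noteq> int k \<longrightarrow> f n = 0" for f n
  proof -
    have summand: "act \<mu> \<nu> (u ^ i) (\<lambda>n. c (i, l) n * act \<mu> \<nu> (d ^ l) f n) n =
        (if (i, l) = (nat n, k) then if n \<ge> 0 then c (i, l) 0 * w * f (int k) else 0 else 0)"
      if "(i, l) \<in> A" for i l
    proof (cases "n - int i + int l = int k")
      case False
      then show ?thesis by (auto simp: act_U_power act_D_power f)
    next
      case True
      show ?thesis
      proof (cases "l = k")
        case l: True
        with True have n: "n = int i" by simp
        have "(\<Prod>m<i. \<mu> (n - int m)) = 1"
          by (rule prod.neutral) (auto simp: \<mu>_def n)
        then show ?thesis using n l by (simp add: act_U_power act_D_power w_def mult.assoc)
      next
        case False
        with k(2)[OF that] have l: "l > k" by simp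
        \<comment> \<open>on its way down from \<open>k\<close> to the negative index \<open>k - l\<close>, the vector meets \<open>\<nu> 0\<close>\<close>
        have "(\<Prod>m<l. \<nu> (n - int i + 1 + int m)) = 0"
          using l True by (intro prod_zero bexI[of _ "l - k - 1"])
             (auto simp: \<nu>_0 of_nat_diff algebra_simps)
        then show ?thesis using l by (simp add: act_U_power act_D_power)
      qed
    qed
    have "act \<mu> \<nu> a f n = (\<Sum>j\<in>A. if j = (nat n, k) then
        if n \<ge> 0 then c j 0 * w * f (int k) else 0 else 0)"
      unfolding act[rule_format]
    proof (rule sum.cong)
      fix j assume "j \<in> A"
      then show "act \<mu> \<nu> (case j of (i, k) \<Rightarrow> u ^ i)
          (\<lambda>n. c j n * act \<mu> \<nu> (case j of (i, k) \<Rightarrow> d ^ k) f n) n =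
          (if j = (nat n, k) then if n \<ge> 0 then c j 0 * w * f (int k) else 0 else 0)"
        by (cases j) (simp only: case_prod_conv summand)
    qed simp
    also have "\<dots> = (if n \<ge> 0 \<and> nat n \<in> I then c (nat n, k) 0 * w * f (int k) else 0)"
      using A by (auto simp: I_def)
    finally show ?thesis .
  qed
  note act' = this
  show ?thesis
  proof (rule exI[of _ k], rule exI[of _ "Max I"], intro conjI allI impI)
    fix f :: "int \<Rightarrow> ('b, 'a) coeff_ring" assume f0: "f (int k) \<noteq> 0" and f: "\<forall>n. n \<noteq> int k \<longrightarrow> f n = 0"
    have "Max I \<in> I" using I by simp
    with f0 w show "act \<mu> \<nu> a f (int (Max I)) \<noteq> 0"
      using c by (auto simp add: act'[OF f] I_def)
    fix n assume "n < 0 \<or> n > int (Max I)"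
    then have "\<not> (n \<ge> 0 \<and> nat n \<in> I)"
      using Max_ge[OF I(1), of "nat n"] by auto
    then show "act \<mu> \<nu> a f n = 0" by (simp only: act'[OF f] if_False)
  qed
qed

text \<open>
  The vector \<open>b v\<^sub>k\<^sub>'\<close> is a nonzero combination of \<open>v\<^sub>0, \<dots>, v\<^sub>i\<^sub>'\<close> in which \<open>v\<^sub>i\<^sub>'\<close> occurs. Applying \<open>d\<close>
  \<open>i'\<close> times kills everything below \<open>v\<^sub>i\<^sub>'\<close> and leaves a nonzero multiple of \<open>v\<^sub>0\<close>, and \<open>u\<^sup>k\<close> carries it to the
  vector \<open>v\<^sub>k\<close> on which \<open>a\<close> is nonzero.
\<close>

lemma prime_ideal:
  assumes "a \<notin> J" "b \<notin> J"
  shows "\<exists>r. a * r * b \<notin> J"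
proof -
  obtain k i :: nat where a: "\<forall>f. f (int k) \<noteq> 0 \<longrightarrow> (\<forall>n. n \<noteq> int k \<longrightarrow> f n = 0) \<longrightarrow>
    act \<mu> \<nu> a f (int i) \<noteq> 0 \<and> (\<forall>n. n < 0 \<or> n > int i \<longrightarrow> act \<mu> \<nu> a f n = 0)"
    using nonzero_on_basis_vector[OF assms(1)] by blast
  obtain k' i' :: nat where b: "\<forall>f. f (int k') \<noteq> 0 \<longrightarrow> (\<forall>n. n \<noteq> int k' \<longrightarrow> f n = 0) \<longrightarrow>
    act \<mu> \<nu> b f (int i') \<noteq> 0 \<and> (\<forall>n. n < 0 \<or> n > int i' \<longrightarrow> act \<mu> \<nu> b f n = 0)"
    using nonzero_on_basis_vector[OF assms(2)] by blast
  define f where "f n = (if n = int k' then 1 else 0 :: ('b, 'a) coeff_ring)" for n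
  define g where "g = act \<mu> \<nu> b f"
  have g: "g (int i') \<noteq> 0" "n < 0 \<Longrightarrow> g n = 0" "n > int i' \<Longrightarrow> g n = 0" for n
    using b[rule_format, of f] by (auto simp: g_def f_def)
  define h where "h = act \<mu> \<nu> (d ^ i') g"
  have h: "h 0 \<noteq> 0" using g(1) by (simp add: h_def act_D_power \<nu>_nonzero)
  have h': "h n = 0" if "n \<noteq> 0" for n
  proof (cases "n < 0 \<and> n + int i' \<ge> 0")
    case True
    then have "(\<Prod>l<i'. \<nu> (n + 1 + int l)) = 0"
      by (intro prod_zero bexI[of _ "nat (- n - 1)"]) (auto simp: \<nu>_0)
    then show ?thesis by (simp add: h_def act_D_power)
  next
    case False
    then show ?thesis using that g(2,3)[of "n + int i'"] by (auto simp: h_def act_D_power)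
  qed
  have "(\<Prod>l<k. \<mu> (int k - int l)) = 1"
    by (rule prod.neutral) (auto simp: \<mu>_def)
  then have "act \<mu> \<nu> a (act \<mu> \<nu> (u ^ k) h) (int i) \<noteq> 0"
    using a[rule_format, of "act \<mu> \<nu> (u ^ k) h"] by (simp add: act_U_power h h')
  then have "act \<mu> \<nu> (a * (u ^ k * d ^ i') * b) f (int i) \<noteq> 0"
    by (simp add: act_mult g_def h_def)
  then show ?thesis using act_J by blast
qed

end

section \<open>The degenerate case\<close>

text \<open>
  If all parameters vanish, then \<open>d\<^sup>2 u = 0\<close>. A further letter \<open>d\<close> only raises the power of \<open>d\<close>, a \<open>t\<^sub>i\<close>
  moves to the front, and the first \<open>u\<close> makes the product zero, at the latest the \<open>u\<close> at the end. The power is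
  arbitrary for the sake of the induction; \<open>k = 0\<close> is the case of interest.
\<close>

lemma (in down_up) degenerate_annihilation:
  assumes zero: "\<alpha> = 0" "\<beta> = 0" "\<phi> = 0"
  shows "d ^ (k + 2) * r * u \<in> J"
proof (induction r arbitrary: k rule: free_algebra_left_induct)
  case (scalar c)
  have du: "d\<^sup>2 * u \<in> J"
    using relations_in_ideal[of \<alpha> \<beta> \<phi>] unfolding relations_def Let_def by (simp add: zero)
  have "d ^ (k + 2) * scalar c * u = d ^ k * scalar c * (d\<^sup>2 * u)"
    by (simp only: power_add mult.assoc scalar_left_commute[of "d\<^sup>2"])
  then show ?case using J_closed(4)[OF du] by simp
next
  case (add a b)
  then show ?case using J_closed(2) by (simp add: distrib_left distrib_right)
next
  case (gen v r)
  show ?case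
  proof (cases v)
    case U
    have du: "d\<^sup>2 * u \<in> J"
      using relations_in_ideal[of \<alpha> \<beta> \<phi>] unfolding relations_def Let_def by (simp add: zero)
    have "d ^ (k + 2) * (gen v * r) * u = d ^ k * (d\<^sup>2 * u) * (r * u)"
      by (simp only: U power_add mult.assoc)
    then show ?thesis using J_closed(5)[OF J_closed(4)[OF du]] by simp
  next
    case D
    have "d ^ (k + 2) * (gen v * r) * u = d ^ (Suc k + 2) * r * u"
      by (simp only: D add_Suc power_Suc2 mult.assoc)
    then show ?thesis using gen[of "Suc k"] by simp
  next
    case (T i)
    have "d ^ (k + 2) * (gen v * r) * u = d ^ (k + 2) * t i * (r * u)"
      by (simp only: T mult.assoc)
    also have "\<dots> \<approx> t i * d ^ (k + 2) * (r * u)"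
      by (intro cong_mult_right cong_sym[OF centralD] central_t)
    also have "\<dots> = t i * (d ^ (k + 2) * r * u)"
      by (simp only: mult.assoc)
    finally show ?thesis by (rule cong_in_J) (intro J_closed(4) gen)
  qed
qed

text \<open>
  With all parameters zero the relations hold as soon as one of \<open>u\<close> and \<open>d\<close> acts as zero, and the other
  may then be an unweighted shift.
\<close>

lemma degenerate_generators_nonzero:
  fixes I :: "('n::{finite,linorder} letter, 'k::field) free_algebra set"
  defines "I \<equiv> relation_ideal 0 0 0"
  shows "gen D ^ 2 \<notin> I" "gen U \<notin> I"
proof -
  let ?z = "\<lambda>n :: int. 0 :: ('n, 'k) coeff_ring" and ?o = "\<lambda>n :: int. 1 :: ('n, 'k) coeff_ring"
  show "gen U \<notin> I"
  proof
    interpret weighted_shifts ?o ?z .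
    assume "gen U \<in> I"
    then have "act ?o ?z (gen U) ?o 0 = 0"
      unfolding I_def
      by (rule act_relation_ideal[rotated 2]) (simp_all add: weight_rec_def sconst_simps const_simps)
    then show False by (simp add: act_gen)
  qed
  show "gen D ^ 2 \<notin> I"
  proof
    interpret weighted_shifts ?z ?o .
    assume "gen D ^ 2 \<in> I"
    then have "act ?z ?o (gen D ^ 2) ?o 0 = 0"
      unfolding I_def
      by (rule act_relation_ideal[rotated 2]) (simp_all add: weight_rec_def sconst_simps const_simps)
    then show False by (simp add: act_D_power)
  qed
qed

section \<open>Existence of the weights\<close>

text \<open>
  For \<open>\<beta> = 0\<close> the weights from index 1 on are the iterates of \<open>p \<mapsto> \<alpha>p + \<phi>\<close> at \<open>Y\<close>. They are nonzero:
  if \<open>\<alpha> \<noteq> 0\<close>, then \<open>Y\<close> keeps the coefficient \<open>\<alpha>\<^sup>m\<close>, and if \<open>\<alpha> = 0\<close>, then all of them after the first are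
  equal to \<open>\<phi> \<noteq> 0\<close>. This is where the hypothesis of the theorem enters.
\<close>

lemma verma_weights:
  fixes \<alpha> :: "'k::field" and \<phi> :: "('n::{finite,linorder}, 'k) mpoly"
  assumes "\<alpha> \<noteq> 0 \<or> \<phi> \<noteq> 0"
  shows "\<exists>\<mu> \<nu>. verma_shifts \<alpha> 0 \<phi> \<mu> \<nu>"
proof -
  define F where "F p = sconst \<alpha> * p + const \<phi>" for p :: "('n, 'k) coeff_ring"
  define \<nu> where "\<nu> n = (if n \<ge> 1 then (F ^^ nat (n - 1)) [:[:0, 1:]:] else 0)" for n :: int
  define \<mu> where "\<mu> n = (if n \<ge> 1 then 1 else 0 :: ('n, 'k) coeff_ring)" for n :: int
  have F: "\<exists>s. (F ^^ m) [:[:0, 1:]:] = [:[:s, Poly_Mapping.single 0 (\<alpha> ^ m):]:]" for m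
    by (induction m) (auto simp: F_def sconst_def const_def mult_single mult.commute)
  have nz: "(F ^^ m) [:[:0, 1:]:] \<noteq> 0" for m
  proof (cases "\<alpha> = 0")
    case True
    with assms have "const \<phi> \<noteq> (0 :: ('n, 'k) coeff_ring)" by simp
    then show ?thesis by (cases m) (simp_all add: F_def True sconst_simps)
  next
    case False
    obtain s where "(F ^^ m) [:[:0, 1:]:] = [:[:s, Poly_Mapping.single 0 (\<alpha> ^ m):]:]" using F by blast
    moreover have "Poly_Mapping.single 0 (\<alpha> ^ m) \<noteq> (0 :: ('n, 'k) mpoly)"
      using False inj_single[of "0 :: 'n \<Rightarrow>\<^sub>0 nat"] by (metis lookup_single_eq lookup_zero power_not_zero)
    ultimately show ?thesis by simp
  qed
  have rec: "weight_rec \<alpha> 0 \<phi> (\<lambda>n. \<mu> n * \<nu> n) n" if "n \<ge> 1" for n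
  proof -
    have "nat n = Suc (nat (n - 1))" using that by simp
    then show ?thesis using that by (simp add: weight_rec_def \<mu>_def \<nu>_def sconst_simps F_def)
  qed
  have "verma_shifts \<alpha> 0 \<phi> \<mu> \<nu>"
  proof
    show "\<mu> n = 0 \<or> weight_rec \<alpha> 0 \<phi> (\<lambda>n. \<mu> n * \<nu> n) n" for n
      using rec[of n] by (cases "n \<ge> 1") (auto simp: \<mu>_def)
    show "\<nu> n = 0 \<or> weight_rec \<alpha> 0 \<phi> (\<lambda>n. \<mu> n * \<nu> n) n" for n
      using rec[of n] by (cases "n \<ge> 1") (auto simp: \<nu>_def)
  qed (use nz in \<open>auto simp: \<mu>_def \<nu>_def\<close>)
  then show ?thesis by blast
qed

text \<open>
  For \<open>\<beta> \<noteq> 0\<close> the recursion can be run in both directions from the weights \<open>X\<close> at \<open>0\<close> and \<open>Y\<close> at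
  \<open>1\<close>. All weights have the form \<open>aX + bY + r\<close> with \<open>a\<close>, \<open>b\<close>, \<open>r\<close> in \<open>k[t\<^sub>1, \<dots>, t\<^sub>n]\<close>. A step in either
  direction multiplies the determinant of the coefficients \<open>(a, b)\<close> of two consecutive weights by
  \<open>-\<beta>\<close> or \<open>-\<beta>\<^sup>-\<^sup>1\<close>. It starts as 1, hence never vanishes, and no weight is zero.
\<close>

lemma two_sided_weights:
  fixes \<alpha> \<beta> :: "'k::field" and \<phi> :: "('n::{finite,linorder}, 'k) mpoly"
  assumes \<beta>: "\<beta> \<noteq> 0"
  shows "\<exists>\<nu>. two_sided_shifts \<alpha> \<beta> \<phi> (\<lambda>_. 1) \<nu>"
proof -
  define step :: "('n, 'k) coeff_ring \<times> ('n, 'k) coeff_ring \<Rightarrow> ('n, 'k) coeff_ring \<times> ('n, 'k) coeff_ring"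
    where "step = (\<lambda>(p, q). (q, sconst \<alpha> * q + sconst \<beta> * p + const \<phi>))"
  define unstep :: "('n, 'k) coeff_ring \<times> ('n, 'k) coeff_ring \<Rightarrow> ('n, 'k) coeff_ring \<times> ('n, 'k) coeff_ring"
    where "unstep = (\<lambda>(p, q). (sconst (inverse \<beta>) * (q - sconst \<alpha> * p - const \<phi>), p))"
  have sb: "sconst \<beta> * sconst (inverse \<beta>) = (1 :: ('n, 'k) coeff_ring)"
    using \<beta> sconst_simps(4)[of \<beta> "inverse \<beta>"] by (simp add: sconst_simps(2))
  have step_unstep: "step (unstep P) = P" for P
    by (cases P) (simp add: step_def unstep_def sb flip: mult.assoc)
  \<comment> \<open>the pair of the weights with indices \<open>n\<close> and \<open>n + 1\<close>\<close>
  define W :: "int \<Rightarrow> ('n, 'k) coeff_ring \<times> ('n, 'k) coeff_ring"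
    where "W n = (if n \<ge> 0 then (step ^^ nat n) ([:0, 1:], [:[:0, 1:]:])
      else (unstep ^^ nat (- n)) ([:0, 1:], [:[:0, 1:]:]))" for n
  have W: "W (n + 1) = step (W n)" for n
  proof (cases "n \<ge> 0")
    case True
    then show ?thesis by (simp add: W_def nat_add_distrib)
  next
    case False
    then have "nat (- n) = Suc (nat (- (n + 1)))" by simp
    then have "W n = unstep (W (n + 1))"
      using False by (cases "n = -1") (simp_all add: W_def)
    then show ?thesis by (simp add: step_unstep)
  qed
  define lin :: "('n, 'k) mpoly \<Rightarrow> ('n, 'k) mpoly \<Rightarrow> ('n, 'k) mpoly \<Rightarrow> ('n, 'k) coeff_ring"
    where "lin a b r = [:[:r, b:], [:a:]:]" for a b r
  define indep where "indep P \<longleftrightarrow> (\<exists>a b r a' b' r'. P = (lin a b r, lin a' b' r') \<and> a * b' - a' * b \<noteq> 0)" for P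
  have lin: "lin a b r + lin a' b' r' = lin (a + a') (b + b') (r + r')"
    "lin a b r - lin a' b' r' = lin (a - a') (b - b') (r - r')"
    "sconst c * lin a b r = lin (Poly_Mapping.single 0 c * a) (Poly_Mapping.single 0 c * b) (Poly_Mapping.single 0 c * r)"
    "const s = lin 0 0 s" for a b r a' b' r' c s
    by (simp_all add: lin_def sconst_def const_def)
  have single: "Poly_Mapping.single 0 c \<noteq> (0 :: ('n, 'k) mpoly)" if "c \<noteq> 0" for c :: 'k
    using that by (metis lookup_single_eq lookup_zero)
  have indep_step: "indep (step P)" if P0: "indep P" for P
  proof -
    obtain a b r a' b' r' where P: "P = (lin a b r, lin a' b' r')" "a * b' - a' * b \<noteq> 0"
      using P0 unfolding indep_def by blast
    let ?\<alpha> = "Poly_Mapping.single 0 \<alpha> :: ('n, 'k) mpoly" and ?\<beta> = "Poly_Mapping.single 0 \<beta> :: ('n, 'k) mpoly"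
    have "step P = (lin a' b' r', lin (?\<alpha> * a' + ?\<beta> * a) (?\<alpha> * b' + ?\<beta> * b) (?\<alpha> * r' + ?\<beta> * r + \<phi>))"
      by (simp add: P step_def lin)
    moreover have "a' * (?\<alpha> * b' + ?\<beta> * b) - (?\<alpha> * a' + ?\<beta> * a) * b' = - ?\<beta> * (a * b' - a' * b)"
      by (simp add: algebra_simps)
    ultimately show ?thesis using P(2) single[OF \<beta>] unfolding indep_def
      by (metis mult_eq_0_iff neg_equal_0_iff_equal)
  qed
  have indep_unstep: "indep (unstep P)" if P0: "indep P" for P
  proof -
    obtain a b r a' b' r' where P: "P = (lin a b r, lin a' b' r')" "a * b' - a' * b \<noteq> 0"
      using P0 unfolding indep_def by blast
    let ?\<alpha> = "Poly_Mapping.single 0 \<alpha> :: ('n, 'k) mpoly"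
      and ?\<beta> = "Poly_Mapping.single 0 (inverse \<beta>) :: ('n, 'k) mpoly"
    have "unstep P = (lin (?\<beta> * (a' - ?\<alpha> * a)) (?\<beta> * (b' - ?\<alpha> * b)) (?\<beta> * (r' - ?\<alpha> * r - \<phi>)), lin a b r)"
      by (simp add: P unstep_def lin)
    moreover have "?\<beta> * (a' - ?\<alpha> * a) * b - a * (?\<beta> * (b' - ?\<alpha> * b)) = - ?\<beta> * (a * b' - a' * b)"
      by (simp add: algebra_simps)
    ultimately show ?thesis using P(2) single[of "inverse \<beta>"] \<beta> unfolding indep_def
      by (metis mult_eq_0_iff neg_equal_0_iff_equal nonzero_imp_inverse_nonzero)
  qed
  have "indep ([:0, 1:], [:[:0, 1:]:])"
    unfolding indep_def lin_def by (intro exI[of _ 0] exI[of _ 1]) (auto intro!: exI simp: one_pCons)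
  then have indep: "indep (W n)" for n
  proof -
    have "indep ((step ^^ m) P)" "indep ((unstep ^^ m) P)" if "indep P" for m P
      using that by (induction m) (simp_all add: indep_step indep_unstep)
    with \<open>indep _\<close> show ?thesis by (simp add: W_def)
  qed
  define \<nu> where "\<nu> n = fst (W n)" for n
  have snd_W: "snd (W n) = \<nu> (n + 1)" for n
    by (simp add: \<nu>_def W step_def split: prod.split)
  have rec: "weight_rec \<alpha> \<beta> \<phi> (\<lambda>n. 1 * \<nu> n) n" for n
  proof -
    have "\<nu> (n + 1) = snd (step (W (n - 1)))" using W[of "n - 1"] snd_W[of n] by simp
    also have "\<dots> = sconst \<alpha> * snd (W (n - 1)) + sconst \<beta> * \<nu> (n - 1) + const \<phi>"
      by (simp add: step_def \<nu>_def split: prod.split)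
    finally show ?thesis by (simp add: weight_rec_def snd_W)
  qed
  have "\<nu> n \<noteq> 0" for n
    using indep[of n] by (auto simp: \<nu>_def indep_def lin_def)
  moreover have "\<nu> 0 = [:0, 1:]" "\<nu> 1 = [:[:0, 1:]:]"
    by (simp_all add: \<nu>_def W_def step_def)
  ultimately have "two_sided_shifts \<alpha> \<beta> \<phi> (\<lambda>_. 1) \<nu>"
    using rec \<beta> by unfold_locales simp_all
  then show ?thesis by blast
qed

section \<open>Primeness of the down-up algebra\<close>

theorem theorem2p3:
  fixes \<alpha> \<beta> :: "'k::field" and \<phi> :: "('n::{finite,linorder}, 'k) mpoly"
  shows "prime_ring (down_up_algebra \<alpha> \<beta> \<phi>) \<longleftrightarrow> \<not> (\<alpha> = 0 \<and> \<beta> = 0 \<and> \<phi> = 0)"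
proof -
  let ?J = "relation_ideal \<alpha> \<beta> \<phi>"
  have prime_iff: "prime_ring (down_up_algebra \<alpha> \<beta> \<phi>) \<longleftrightarrow>
      1 \<notin> ?J \<and> (\<forall>a b. (\<forall>r. a * r * b \<in> ?J) \<longrightarrow> a \<in> ?J \<or> b \<in> ?J)"
    using prime_ring_quotient_iff[OF ideal_relation_ideal]
    by (simp add: down_up_algebra_def relation_ideal_def)
  show ?thesis
  proof
    assume prime: "prime_ring (down_up_algebra \<alpha> \<beta> \<phi>)"
    show "\<not> (\<alpha> = 0 \<and> \<beta> = 0 \<and> \<phi> = 0)"
    proof
      assume zero: "\<alpha> = 0 \<and> \<beta> = 0 \<and> \<phi> = 0"
      then have "gen D ^ 2 * r * gen U \<in> ?J" for r
        using down_up.degenerate_annihilation[of \<alpha> \<beta> \<phi> 0 r] by (simp add: power2_eq_square)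
      with prime prime_iff have "gen D ^ 2 \<in> ?J \<or> gen U \<in> ?J" by blast
      with zero show False using degenerate_generators_nonzero by auto
    qed
  next
    assume *: "\<not> (\<alpha> = 0 \<and> \<beta> = 0 \<and> \<phi> = 0)"
    have "1 \<notin> ?J \<and> (\<forall>a b. a \<notin> ?J \<longrightarrow> b \<notin> ?J \<longrightarrow> (\<exists>r. a * r * b \<notin> ?J))"
    proof (cases "\<beta> = 0")
      case True
      with * obtain \<mu> \<nu> where "verma_shifts \<alpha> \<beta> \<phi> \<mu> \<nu>" using verma_weights by blast
      then interpret verma_shifts \<alpha> \<beta> \<phi> \<mu> \<nu> .
      show ?thesis using prime_ideal act_J[of 1 "\<lambda>_. 1"] by auto
    next
      case False
      then obtain \<nu> where "two_sided_shifts \<alpha> \<beta> \<phi> (\<lambda>_. 1) \<nu>" using two_sided_weights by blast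
      then interpret two_sided_shifts \<alpha> \<beta> \<phi> "\<lambda>_. 1" \<nu> .
      show ?thesis using prime_ideal act_J[of 1 "\<lambda>_. 1"] by auto
    qed
    then show "prime_ring (down_up_algebra \<alpha> \<beta> \<phi>)" unfolding prime_iff by blast
  qed
qed

end
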